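(* Let $S_t=\sum_{-r<s\le t}(\Delta L_s)^2$ and $S^n_t=\sum_{-r<s\le t}(\Delta L_s)^2\mathbf 1_{\{|\Delta L_s|\ge1/n\}}$, $n\in\mathbb N$. Let $X$ be the unique solution of $dX_t=b(X)_t\,dt+c_\nu X_{t-}\,dS_t$ and $X^n$ the unique solution of $dX^n_t=b^n(X^n)_t\,dt+c_\nu X^n_{t-}\,dS^n_t$, both with initial condition $\Phi$ on $[-r,0]$, where $b(H)_t=\eta-c_\mu H_t+\int_{t-p}^tf_\mu(u-t)H_u\,du+\int_{t-q+}^tf_\nu(u-t)H_{u-}\,dS_u$ and $b^n$ is defined identically with $S^n$ in place of $S$. Then $X^n\to X$ uniformly on compacts in probability as $n\to\infty$.
   Context: Let $p,q\ge0$, $r:=p\vee q$, $(\Omega,\mathcal F,\mathbb F=(\mathcal F_t)_{t\ge-r},\mathbb P)$ a filtered probability space with the usual conditions, and $(L_t)_{t\ge-r}$ a càdlàg adapted centered Lévy process with $L_{-r}=0$, increments independent of the past and stationary, no Brownian component, and $\mathbb E[L_1^4]<\infty$. Parameters: $\eta>0$, $c_\mu,c_\nu>0$, $f_\mu,f_\nu$ nonnegative continuous supported on $[-p,0]$, $[-q,0]$. $\Phi$ is a càdlàg process on $[-r,0]$ adapted to the natural filtration of $L$ with $\mathbb E[\sup_{[-r,0]}|\Phi|^2]<\infty$. Solutions are understood as the unique adapted càdlàg processes $X$ on $[-r,\infty)$ with $\mathbb E[\sup_{s\in[-r,t]}|X_s|^2]<\infty$ for all $t$. Convergence uniformly on compacts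 in probability means $\sup_{s\le t}|X^n_s-X_s|\to0$ in probability for every $t>0$. *)

theory Defs
  imports "HOL-Probability.Probability"
begin

definition lft :: "(real \<Rightarrow> real) \<Rightarrow> real \<Rightarrow> real" where
  "lft g s = Lim (at_left s) g"

definition jump :: "(real \<Rightarrow> real) \<Rightarrow> real \<Rightarrow> real" where
  "jump g s = g s - lft g s"

definition cadlag_from :: "real \<Rightarrow> (real \<Rightarrow> real) \<Rightarrow> bool" where
  "cadlag_from a g \<longleftrightarrow>
     (\<forall>t\<ge>a. (g \<longlongrightarrow> g t) (at_right t)) \<and> (\<forall>t>a. \<exists>l. (g \<longlongrightarrow> l) (at_left t))"

definition cadlag_on :: "real \<Rightarrow> real \<Rightarrow> (real \<Rightarrow> real) \<Rightarrow> bool" where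
  "cadlag_on a b g \<longleftrightarrow>
     (\<forall>t\<in>{a..<b}. (g \<longlongrightarrow> g t) (at t within {t<..b})) \<and>
     (\<forall>t\<in>{a<..b}. \<exists>l. (g \<longlongrightarrow> l) (at t within {a..<t}))"

definition usual_filtration :: "'a measure \<Rightarrow> real \<Rightarrow> (real \<Rightarrow> 'a measure) \<Rightarrow> bool" where
  "usual_filtration M r F \<longleftrightarrow>
     (\<forall>t\<ge>-r. space (F t) = space M \<and> sets (F t) \<subseteq> sets M) \<and>
     (\<forall>s t. -r \<le> s \<longrightarrow> s \<le> t \<longrightarrow> sets (F s) \<subseteq> sets (F t)) \<and>
     (\<forall>t\<ge>-r. sets (F t) = (\<Inter>s\<in>{t<..}. sets (F s))) \<and>
     (\<forall>N\<in>null_sets M. \<forall>A\<subseteq>N. A \<in> sets (F (-r)))"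

definition adapted :: "real \<Rightarrow> (real \<Rightarrow> 'a measure) \<Rightarrow> (real \<Rightarrow> 'a \<Rightarrow> real) \<Rightarrow> bool" where
  "adapted r F X \<longleftrightarrow> (\<forall>t\<ge>-r. X t \<in> borel_measurable (F t))"

definition levy_pure_jump_centered ::
  "'a measure \<Rightarrow> real \<Rightarrow> (real \<Rightarrow> 'a measure) \<Rightarrow> (real \<Rightarrow> 'a \<Rightarrow> real) \<Rightarrow> bool" where
  "levy_pure_jump_centered M r F L \<longleftrightarrow>
     adapted r F L \<and>
     (\<forall>\<omega>\<in>space M. cadlag_from (-r) (\<lambda>t. L t \<omega>)) \<and>
     (\<forall>\<omega>\<in>space M. L (-r) \<omega> = 0) \<and>
     \<comment> \<open>increments independent of the past\<close>
     (\<forall>s t. -r \<le> s \<longrightarrow> s \<le> t \<longrightarrow>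
        (\<forall>A\<in>sets (F s). \<forall>B\<in>sets borel.
           measure M (A \<inter> {\<omega>\<in>space M. L t \<omega> - L s \<omega> \<in> B}) =
           measure M A * measure M {\<omega>\<in>space M. L t \<omega> - L s \<omega> \<in> B})) \<and>
     \<comment> \<open>stationary increments\<close>
     (\<forall>s t h. -r \<le> s \<longrightarrow> s \<le> t \<longrightarrow> 0 \<le> h \<longrightarrow>
        distr M borel (\<lambda>\<omega>. L (t + h) \<omega> - L (s + h) \<omega>) = distr M borel (\<lambda>\<omega>. L t \<omega> - L s \<omega>)) \<and>
     \<comment> \<open>no Brownian component: Levy--Khintchine with zero Gaussian part\<close>
     (\<exists>\<nu>::real measure. \<exists>\<gamma>::real.
        sets \<nu> = sets borel \<and> emeasure \<nu> {0} = 0 \<and>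
        (\<integral>\<^sup>+ x. ennreal (min 1 (x\<^sup>2)) \<partial>\<nu>) < \<infinity> \<and>
        (\<forall>u. char (distr M borel (\<lambda>\<omega>. L 1 \<omega> - L 0 \<omega>)) u =
              exp (\<i> * complex_of_real (\<gamma> * u) +
                   (CLINT x|\<nu>. iexp (u * x) - 1 - \<i> * complex_of_real (u * x) * indicator {-1..1} x)))) \<and>
     \<comment> \<open>centered and finite fourth moment\<close>
     (\<forall>t\<ge>-r. integrable M (L t) \<and> integral\<^sup>L M (L t) = 0) \<and>
     integrable M (\<lambda>\<omega>. (L 1 \<omega>) ^ 4)"

definition natural_filt :: "'a measure \<Rightarrow> real \<Rightarrow> (real \<Rightarrow> 'a \<Rightarrow> real) \<Rightarrow> real \<Rightarrow> 'a measure" where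
  "natural_filt M r L t =
     sigma (space M) (\<Union>u\<in>{-r..t}. {L u -` B \<inter> space M | B. B \<in> sets borel})"

definition sqjump :: "real \<Rightarrow> (real \<Rightarrow> 'a \<Rightarrow> real) \<Rightarrow> 'a \<Rightarrow> real \<Rightarrow> real" where
  "sqjump r L \<omega> t = (\<Sum>\<^sub>\<infinity>s\<in>{-r<..t}. (jump (\<lambda>u. L u \<omega>) s)\<^sup>2)"

definition sqjump_trunc :: "real \<Rightarrow> (real \<Rightarrow> 'a \<Rightarrow> real) \<Rightarrow> nat \<Rightarrow> 'a \<Rightarrow> real \<Rightarrow> real" where
  "sqjump_trunc r L n \<omega> t =
     (\<Sum>\<^sub>\<infinity>s\<in>{-r<..t}. (jump (\<lambda>u. L u \<omega>) s)\<^sup>2 *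
        indicator {x. \<bar>x\<bar> \<ge> 1 / real n} (jump (\<lambda>u. L u \<omega>) s))"

definition stint :: "(real \<Rightarrow> real) \<Rightarrow> real set \<Rightarrow> (real \<Rightarrow> real) \<Rightarrow> real" where
  "stint S A f = (LINT u:A|interval_measure S. f u)"

definition drift ::
  "real \<Rightarrow> real \<Rightarrow> (real \<Rightarrow> real) \<Rightarrow> (real \<Rightarrow> real) \<Rightarrow> real \<Rightarrow> real \<Rightarrow>
   (real \<Rightarrow> real) \<Rightarrow> (real \<Rightarrow> real) \<Rightarrow> real \<Rightarrow> real" where
  "drift \<eta> c\<^sub>\<mu> f\<^sub>\<mu> f\<^sub>\<nu> p q S H t =
     \<eta> - c\<^sub>\<mu> * H t + (LBINT u=t-p..t. f\<^sub>\<mu> (u - t) * H u)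
       + stint S {t-q<..t} (\<lambda>u. f\<^sub>\<nu> (u - t) * lft H u)"

definition is_solution ::
  "'a measure \<Rightarrow> (real \<Rightarrow> 'a measure) \<Rightarrow> real \<Rightarrow> real \<Rightarrow> real \<Rightarrow> real \<Rightarrow> real \<Rightarrow>
   (real \<Rightarrow> real) \<Rightarrow> (real \<Rightarrow> real) \<Rightarrow> real \<Rightarrow>
   ('a \<Rightarrow> real \<Rightarrow> real) \<Rightarrow> (real \<Rightarrow> 'a \<Rightarrow> real) \<Rightarrow> (real \<Rightarrow> 'a \<Rightarrow> real) \<Rightarrow> bool" where
  "is_solution M F p q \<eta> c\<^sub>\<mu> c\<^sub>\<nu> f\<^sub>\<mu> f\<^sub>\<nu> r S \<Phi> X \<longleftrightarrow>
     adapted r F X \<and>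
     (\<forall>\<omega>\<in>space M. cadlag_from (-r) (\<lambda>t. X t \<omega>)) \<and>
     (\<forall>t\<ge>-r. (\<integral>\<^sup>+\<omega>. (SUP s\<in>{-r..t}. ennreal ((X s \<omega>)\<^sup>2)) \<partial>M) < \<infinity>) \<and>
     (AE \<omega> in M.
        (\<forall>t\<in>{-r..0}. X t \<omega> = \<Phi> t \<omega>) \<and>
        (\<forall>t\<ge>0. X t \<omega> = \<Phi> 0 \<omega>
            + (LBINT s=0..t. drift \<eta> c\<^sub>\<mu> f\<^sub>\<mu> f\<^sub>\<nu> p q (S \<omega>) (\<lambda>u. X u \<omega>) s)
            + c\<^sub>\<nu> * stint (S \<omega>) {0<..t} (\<lambda>s. lft (\<lambda>u. X u \<omega>) s)))"

definition ucp_conv ::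
  "'a measure \<Rightarrow> real \<Rightarrow> (nat \<Rightarrow> real \<Rightarrow> 'a \<Rightarrow> real) \<Rightarrow> (real \<Rightarrow> 'a \<Rightarrow> real) \<Rightarrow> bool" where
  "ucp_conv M r Xn X \<longleftrightarrow>
     (\<forall>t>0. \<forall>\<epsilon>>0.
        (\<forall>n. {\<omega>\<in>space M. (SUP s\<in>{-r..t}. \<bar>Xn n s \<omega> - X s \<omega>\<bar>) > \<epsilon>} \<in> sets M) \<and>
        (\<lambda>n. measure M {\<omega>\<in>space M. (SUP s\<in>{-r..t}. \<bar>Xn n s \<omega> - X s \<omega>\<bar>) > \<epsilon>}) \<longlonglongrightarrow> 0)"

end

theory Submission
  imports Defs
begin

text \<open>The convergence holds pathwise, almost surely. Square integrability and orthogonality of the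
  increments of \<open>L\<close> bound the expected sums of squared increments along partitions, so by Fatou's lemma
  \<open>S\<close> is almost surely finite, and the mass of the measure \<open>dS - dS\<^sup>n \<ge> 0\<close> on a compact interval tends
  to \<open>0\<close>. For fixed \<open>\<omega>\<close> the two equations differ by terms controlled by this mass and by the running
  supremum of \<open>\<bar>X\<^sup>n - X\<bar>\<close>, integrated against Lebesgue measure and \<open>dS\<close>; a Gronwall argument
  then gives uniform convergence.\<close>

section \<open>Cadlag functions and pure-jump Stieltjes measures\<close>

text \<open>A jump of \<open>S\<close> may be arbitrarily large, so a Gronwall step across an atom
  is no contraction. The integrand against \<open>dS\<close> is a left limit, however: an atom at
  \<open>s\<close> multiplies only what happened strictly before \<open>s\<close>, so its weight
  merely enlarges a constant in front of a quantity already known to vanish. What must be small is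
  the mass of the open interval still under consideration, and close to any point this is so on
  either side. The second obstacle is that no bound on \<open>Xn n\<close> uniform in
  \<open>n\<close> is at hand. The error of replacing \<open>S\<close> by its truncation is
  therefore always charged to the fixed path \<open>X\<close>, through
  \<open>f b - g a = (f - g) b - g (a - b)\<close>; bounds on the approximating path serve only
  integrability and summability. Probability enters through a single fact, the summability of the
  squared jumps on bounded intervals along almost every path, and through the final passage from
  almost sure convergence to convergence in probability. On paths where summability fails,
  \<open>infsum\<close> takes its default value 0, so such paths must be discarded.\<close>

lemma cadlag_from_tendsto_lft:
  assumes "cadlag_from a g" "a < t"
  shows "(g \<longlongrightarrow> lft g t) (at_left t)"
proof -
  obtain l where l: "(g \<longlongrightarrow> l) (at_left t)"
    using assms unfolding cadlag_from_def by auto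
  then have "lft g t = l"
    unfolding lft_def by (intro tendsto_Lim) auto
  with l show ?thesis by simp
qed

lemma cadlag_from_tendsto_right:
  assumes "cadlag_from a g" "a \<le> t"
  shows "(g \<longlongrightarrow> g t) (at_right t)"
  using assms unfolding cadlag_from_def by auto

lemma cadlag_from_diff:
  assumes "cadlag_from a g" "cadlag_from a h"
  shows "cadlag_from a (\<lambda>t. g t - h t)"
  using assms unfolding cadlag_from_def by (blast intro: tendsto_diff)

lemma lft_diff:
  assumes "cadlag_from a g" "cadlag_from a h" "a < t"
  shows "lft (\<lambda>t. g t - h t) t = lft g t - lft h t"
  unfolding lft_def[of "\<lambda>t. g t - h t"]
  by (intro tendsto_Lim tendsto_diff cadlag_from_tendsto_lft assms) (use assms in auto)

text \<open>Only values strictly before \<open>t\<close> have to be bounded. This strictness is what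
  keeps the atom at the right end of an interval out of the Gronwall estimate.\<close>

lemma abs_lft_le:
  assumes "cadlag_from a g" "a < t" "\<And>s. a \<le> s \<Longrightarrow> s < t \<Longrightarrow> \<bar>g s\<bar> \<le> B"
  shows "\<bar>lft g t\<bar> \<le> B"
proof (rule tendsto_upperbound)
  show "((\<lambda>s. \<bar>g s\<bar>) \<longlongrightarrow> \<bar>lft g t\<bar>) (at_left t)"
    by (intro tendsto_rabs cadlag_from_tendsto_lft[OF assms(1,2)])
  show "\<forall>\<^sub>F s in at_left t. \<bar>g s\<bar> \<le> B"
    using eventually_at_left_real[OF assms(2)] by eventually_elim (use assms(3) in auto)
qed simp

text \<open>Bisection: boundedness passes to the union of adjacent intervals, and near each point it
  follows from the two one-sided limits.\<close>

lemma cadlag_from_bounded: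
  assumes g: "cadlag_from a g"
  obtains B where "0 \<le> B" "\<And>s. a \<le> s \<Longrightarrow> s \<le> b \<Longrightarrow> \<bar>g s\<bar> \<le> B"
proof (cases "a \<le> b")
  case False
  then show ?thesis by (intro that[of 0]) auto
next
  case True
  \<comment> \<open>The local intervals of the bisection may stick out to the left of
    \<open>a\<close>, where nothing is known about \<open>g\<close>; hence the clause
    \<open>a \<le> s\<close>. At \<open>x = a\<close> it also makes the missing left limit
    irrelevant.\<close>
  define P where "P x y \<longleftrightarrow> (\<exists>B. \<forall>s. a \<le> s \<longrightarrow> x \<le> s \<longrightarrow> s \<le> y \<longrightarrow> \<bar>g s\<bar> \<le> B)" for x y
  have "P a b"
    using True
  proof (induction rule: Bolzano)
    case (trans x y z)
    then obtain B C where "\<forall>s. a \<le> s \<longrightarrow> x \<le> s \<longrightarrow> s \<le> y \<longrightarrow> \<bar>g s\<bar> \<le> B"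
      "\<forall>s. a \<le> s \<longrightarrow> y \<le> s \<longrightarrow> s \<le> z \<longrightarrow> \<bar>g s\<bar> \<le> C"
      unfolding P_def by auto
    then show ?case unfolding P_def
      by (intro exI[of _ "max B C"] allI impI) (auto simp: le_max_iff_disj)
  next
    case (local x)
    have "\<forall>\<^sub>F s in at_right x. \<bar>g s\<bar> < \<bar>g x\<bar> + 1"
      using cadlag_from_tendsto_right[OF g local(1), THEN tendsto_rabs]
      by (rule order_tendstoD) simp
    then obtain e1 where e1: "x < e1" "\<And>s. x < s \<Longrightarrow> s < e1 \<Longrightarrow> \<bar>g s\<bar> < \<bar>g x\<bar> + 1"
      unfolding eventually_at_right_field by auto
    have "\<exists>e2<x. \<forall>s. a \<le> s \<longrightarrow> e2 < s \<longrightarrow> s < x \<longrightarrow> \<bar>g s\<bar> < \<bar>lft g x\<bar> + 1"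
    proof (cases "a < x")
      case True
      have "\<forall>\<^sub>F s in at_left x. \<bar>g s\<bar> < \<bar>lft g x\<bar> + 1"
        using cadlag_from_tendsto_lft[OF g True, THEN tendsto_rabs]
        by (rule order_tendstoD) simp
      then show ?thesis
        unfolding eventually_at_left_field by auto
    next
      case False
      then show ?thesis using local by (intro exI[of _ "x - 1"]) auto
    qed
    then obtain e2 where e2: "e2 < x" "\<And>s. a \<le> s \<Longrightarrow> e2 < s \<Longrightarrow> s < x \<Longrightarrow> \<bar>g s\<bar> < \<bar>lft g x\<bar> + 1"
      by auto
    show ?case
    proof (intro exI[of _ "min (e1 - x) (x - e2)"] conjI allI impI)
      show "0 < min (e1 - x) (x - e2)" using e1 e2 by auto
      fix u v assume uv: "u \<le> x \<and> x \<le> v \<and> v - u < min (e1 - x) (x - e2)"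
      show "P u v"
        unfolding P_def
      proof (intro exI[of _ "\<bar>g x\<bar> + \<bar>lft g x\<bar> + 1"] allI impI)
        fix s assume s: "a \<le> s" "u \<le> s" "s \<le> v"
        consider "s < x" | "s = x" | "s > x" by linarith
        then show "\<bar>g s\<bar> \<le> \<bar>g x\<bar> + \<bar>lft g x\<bar> + 1"
        proof cases
          case 1 then show ?thesis using e2(2)[of s] uv s by linarith
        next
          case 3 then show ?thesis using e1(2)[of s] uv s by linarith
        qed auto
      qed
    qed
  qed
  then obtain B where "\<forall>s. a \<le> s \<longrightarrow> a \<le> s \<longrightarrow> s \<le> b \<longrightarrow> \<bar>g s\<bar> \<le> B"
    unfolding P_def by auto
  then show ?thesis by (intro that[of "max B 0"]) (auto simp: le_max_iff_disj)
qed

section \<open>Borel measurability of cadlag paths by sampling on a grid\<close>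

lemma tendsto_at_right_grid:
  fixes u :: real
  shows "filterlim (\<lambda>k. (of_int \<lfloor>u * real (Suc k)\<rfloor> + 1) / real (Suc k)) (at_right u) sequentially"
proof -
  let ?f = "\<lambda>k. (of_int \<lfloor>u * real (Suc k)\<rfloor> + 1) / real (Suc k)"
  have *: "u < ?f k" "?f k \<le> u + 1 / real (Suc k)" for k
  proof -
    have N: "real (Suc k) > 0" by simp
    \<comment> \<open>The inequality must be strict even when \<open>u\<close> lies on the grid,
      hence the floor plus one rather than the ceiling.\<close>
    show "u < ?f k"
      unfolding pos_less_divide_eq[OF N] by (rule real_of_int_floor_add_one_gt)
    have "?f k \<le> (u * real (Suc k) + 1) / real (Suc k)"
      by (intro divide_right_mono add_right_mono of_int_floor_le) simp
    also have "\<dots> = u + 1 / real (Suc k)"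
      using N by (simp add: add_divide_distrib del: of_nat_Suc)
    finally show "?f k \<le> u + 1 / real (Suc k)" .
  qed
  have "?f \<longlonglongrightarrow> u"
  proof (rule tendsto_sandwich)
    show "(\<lambda>k. u) \<longlonglongrightarrow> u" by simp
    show "(\<lambda>k. u + 1 / real (Suc k)) \<longlonglongrightarrow> u"
      using tendsto_add[OF tendsto_const[of u] LIMSEQ_Suc[OF lim_1_over_n]] by simp
  qed (auto simp del: of_nat_Suc intro!: always_eventually intro: less_imp_le[OF *(1)] *(2))
  then show ?thesis
    using *(1) by (intro tendsto_imp_filterlim_at_right always_eventually) auto
qed

text \<open>The sampling point is the largest grid point strictly below \<open>u\<close>. Besides
  measurability of left limits, this also serves to locate the partition interval that contains a
  given jump time.\<close>

lemma tendsto_at_left_grid: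
  fixes u :: real
  shows "filterlim (\<lambda>k. (of_int \<lceil>u * real (Suc k)\<rceil> - 1) / real (Suc k)) (at_left u) sequentially"
proof -
  let ?f = "\<lambda>k. (of_int \<lceil>u * real (Suc k)\<rceil> - 1) / real (Suc k)"
  have *: "?f k < u" "u - 1 / real (Suc k) \<le> ?f k" for k
  proof -
    have N: "real (Suc k) > 0" by simp
    show "?f k < u"
      unfolding pos_divide_less_eq[OF N] using of_int_ceiling_diff_one_le[of "u * real (Suc k)"]
        ceiling_correct[of "u * real (Suc k)"] by (simp del: of_nat_Suc)
    have "u - 1 / real (Suc k) = (u * real (Suc k) - 1) / real (Suc k)"
      using N by (simp add: diff_divide_distrib del: of_nat_Suc)
    also have "\<dots> \<le> ?f k"
      by (intro divide_right_mono diff_right_mono le_of_int_ceiling) simp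
    finally show "u - 1 / real (Suc k) \<le> ?f k" .
  qed
  have "?f \<longlonglongrightarrow> u"
  proof (rule tendsto_sandwich)
    show "(\<lambda>k. u - 1 / real (Suc k)) \<longlonglongrightarrow> u"
      using tendsto_diff[OF tendsto_const[of u] LIMSEQ_Suc[OF lim_1_over_n]] by simp
    show "(\<lambda>k. u) \<longlonglongrightarrow> u" by simp
  qed (auto simp del: of_nat_Suc intro!: always_eventually intro: less_imp_le[OF *(1)] *(2))
  then show ?thesis
    using *(1) by (intro tendsto_imp_filterlim_at_left always_eventually) auto
qed

text \<open>The value at the next grid point depends on \<open>u\<close> only through an integer, so
  it is measurable whatever \<open>g\<close> is; right continuity makes these samples converge to
  \<open>g u\<close>. The indicator removes the region where \<open>g\<close> is arbitrary.\<close>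

lemma borel_measurable_cadlag_from:
  assumes g: "cadlag_from a g"
  shows "(\<lambda>u. indicator {a..} u * g u) \<in> borel_measurable borel"
proof (rule borel_measurable_LIMSEQ_real)
  fix u :: real
  show "(\<lambda>k. indicator {a..} u * g ((of_int \<lfloor>u * real (Suc k)\<rfloor> + 1) / real (Suc k)))
      \<longlonglongrightarrow> indicator {a..} u * g u"
  proof (cases "a \<le> u")
    case True
    show ?thesis
      by (intro tendsto_mult tendsto_const
          filterlim_compose[OF cadlag_from_tendsto_right[OF g True] tendsto_at_right_grid])
  qed (auto simp: indicator_def)
next
  fix k :: nat
  have "(\<lambda>u. g ((of_int \<lfloor>u * real (Suc k)\<rfloor> + 1) / real (Suc k))) \<in> borel_measurable borel"
    by (rule measurable_compose[where N="count_space UNIV" and f="\<lambda>u. \<lfloor>u * real (Suc k)\<rfloor>"]) auto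
  then show "(\<lambda>u. indicator {a..} u * g ((of_int \<lfloor>u * real (Suc k)\<rfloor> + 1) / real (Suc k)))
      \<in> borel_measurable borel"
    by measurable
qed

lemma borel_measurable_lft:
  assumes g: "cadlag_from a g"
  shows "(\<lambda>u. indicator {a<..} u * lft g u) \<in> borel_measurable borel"
proof (rule borel_measurable_LIMSEQ_real)
  fix u :: real
  show "(\<lambda>k. indicator {a<..} u * g ((of_int \<lceil>u * real (Suc k)\<rceil> - 1) / real (Suc k)))
      \<longlonglongrightarrow> indicator {a<..} u * lft g u"
  proof (cases "a < u")
    case True
    show ?thesis
      by (intro tendsto_mult tendsto_const
          filterlim_compose[OF cadlag_from_tendsto_lft[OF g True] tendsto_at_left_grid])
  qed (auto simp: indicator_def)
next
  fix k :: nat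
  have "(\<lambda>u. g ((of_int \<lceil>u * real (Suc k)\<rceil> - 1) / real (Suc k))) \<in> borel_measurable borel"
    by (rule measurable_compose[where N="count_space UNIV" and f="\<lambda>u. \<lceil>u * real (Suc k)\<rceil>"]) auto
  then show "(\<lambda>u. indicator {a<..} u * g ((of_int \<lceil>u * real (Suc k)\<rceil> - 1) / real (Suc k)))
      \<in> borel_measurable borel"
    by measurable
qed

section \<open>Distribution functions of pure-jump measures; along a fixed path
  \<open>sqjump\<close> and \<open>sqjump_trunc\<close> are instances of
  \<open>cumul\<close>\<close>

definition cumul :: "real \<Rightarrow> (real \<Rightarrow> real) \<Rightarrow> real \<Rightarrow> real" where
  "cumul c a t = (\<Sum>\<^sub>\<infinity>s\<in>{c<..t}. a s)"

locale jump_weights =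
  fixes c :: real and a :: "real \<Rightarrow> real"
  assumes weight_nonneg: "0 \<le> a s"
    and weight_summable: "a summable_on {c<..t}"
begin

abbreviation S :: "real \<Rightarrow> real" where
  "S \<equiv> cumul c a"

lemma weight_summable_Ioc: "c \<le> x \<Longrightarrow> a summable_on {x<..y}"
  by (rule summable_on_subset[OF weight_summable[of y]]) auto

lemma S_diff:
  assumes "c \<le> x" "x \<le> y"
  shows "S y - S x = (\<Sum>\<^sub>\<infinity>s\<in>{x<..y}. a s)"
proof -
  have "{c<..y} = {c<..x} \<union> {x<..y}" using assms by auto
  then have "S y = S x + (\<Sum>\<^sub>\<infinity>s\<in>{x<..y}. a s)"
    unfolding cumul_def using assms
    by (auto intro!: infsum_Un_disjoint weight_summable weight_summable_Ioc)
  then show ?thesis by simp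
qed

lemma S_mono: "x \<le> y \<Longrightarrow> S x \<le> S y"
  unfolding cumul_def by (intro infsum_mono2 weight_summable) (auto intro: weight_nonneg)

lemma S_nonneg: "0 \<le> S x"
  unfolding cumul_def by (intro infsum_nonneg weight_nonneg)

lemma S_left: "x \<le> c \<Longrightarrow> S x = 0"
  unfolding cumul_def by simp

text \<open>Finitely many points carry all but \<open>e/2\<close> of the mass of
  \<open>{x<..x+1}\<close>, and each of them lies at a positive distance to the right of
  \<open>x\<close>. Closer to \<open>x\<close> than all of them, only the remaining mass is
  met.\<close>

lemma S_right_small:
  assumes e: "0 < e"
  shows "\<exists>d>0. \<forall>y. x < y \<longrightarrow> y < x + d \<longrightarrow> S y - S x < e"
proof (cases "x < c")
  case True
  then show ?thesis using e by (intro exI[of _ "c - x"]) (auto simp: S_left)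
next
  case False
  then have xc: "c \<le> x" by simp
  obtain J where J: "finite J" "J \<subseteq> {x<..x+1}"
      "dist (sum a J) (\<Sum>\<^sub>\<infinity>s\<in>{x<..x+1}. a s) \<le> e/2"
    using infsum_finite_approximation[OF weight_summable_Ioc[OF xc, of "x+1"], of "e/2"] e by auto
  \<comment> \<open>Inserting 1 keeps the set non-empty and the points \<open>y\<close> below
    \<open>x + 1\<close>.\<close>
  define d where "d = Min (insert 1 ((\<lambda>j. j - x) ` J))"
  have d: "0 < d" "d \<le> 1" "\<And>j. j \<in> J \<Longrightarrow> x + d \<le> j"
    unfolding d_def using J
    by (auto simp: Min_gr_iff Min_le_iff) (metis Min_le add.commute finite_imageI finite_insert image_eqI insertI2 le_diff_eq)
  have "S y - S x < e" if y: "x < y" "y < x + d" for y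
  proof -
    have "sum a J \<le> (\<Sum>\<^sub>\<infinity>s\<in>{y<..x+1}. a s)"
      using J d y xc by (intro finite_sum_le_infsum weight_summable_Ioc) (force intro: weight_nonneg)+
    also have "\<dots> = S (x+1) - S y"
      using d y xc by (intro S_diff[symmetric]) auto
    finally have "sum a J \<le> S (x+1) - S y" .
    moreover have "(\<Sum>\<^sub>\<infinity>s\<in>{x<..x+1}. a s) = S (x+1) - S x"
      using xc by (intro S_diff[symmetric]) auto
    ultimately show ?thesis
      using J(3)[unfolded dist_real_def] e by linarith
  qed
  with d(1) show ?thesis by auto
qed

lemma S_right_cont: "continuous (at_right x) S"
  unfolding continuous_within
proof (rule tendstoI)
  fix e :: real assume "0 < e"
  then obtain d where "d > 0" "\<forall>y. x < y \<longrightarrow> y < x + d \<longrightarrow> S y - S x < e"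
    using S_right_small by blast
  then show "\<forall>\<^sub>F y in at_right x. dist (S y) (S x) < e"
    unfolding eventually_at_right_field using S_mono[of x]
    by (intro exI[of _ "x + d"]) (auto simp: dist_real_def)
qed

text \<open>The discrete measure with mass \<open>a s\<close> at each \<open>s > c\<close>. The
  push-forward along the identity only restricts the sigma-algebra from all sets to the Borel sets,
  so that an equality with an \<open>interval_measure\<close> is possible.\<close>

definition atoms :: "real measure" where
  "atoms = distr (density (count_space UNIV) (\<lambda>s. ennreal (indicator {c<..} s * a s))) borel (\<lambda>s. s)"

lemma emeasure_atoms_Ioc:
  assumes "x \<le> y"
  shows "emeasure atoms {x<..y} = ennreal (S y - S x)"
proof -
  \<comment> \<open>Clipping at \<open>c\<close> does not change the mass, since \<open>S\<close>
    vanishes to the left of \<open>c\<close>.\<close>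
  let ?x = "max c x" and ?y = "max c y"
  have abs: "Infinite_Set_Sum.abs_summable_on a {?x<..?y}"
    using weight_summable_Ioc[of ?x ?y] by (simp add: abs_summable_equivalent[symmetric] weight_nonneg)
  have "emeasure atoms {x<..y} =
      (\<integral>\<^sup>+s. ennreal (indicator {c<..} s * a s) * indicator {x<..y} s \<partial>count_space UNIV)"
    unfolding atoms_def by (simp add: emeasure_distr emeasure_density)
  also have "\<dots> = (\<integral>\<^sup>+s. ennreal (a s) * indicator {?x<..?y} s \<partial>count_space UNIV)"
    by (intro nn_integral_cong) (auto simp: indicator_def)
  also have "\<dots> = (\<integral>\<^sup>+s. ennreal (a s) \<partial>count_space {?x<..?y})"
    by (subst nn_integral_count_space_indicator) auto
  also have "\<dots> = ennreal (integral\<^sup>L (count_space {?x<..?y}) a)"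
    using abs by (intro nn_integral_eq_integral) (auto simp: abs_summable_on_def weight_nonneg)
  also have "integral\<^sup>L (count_space {?x<..?y}) a = (\<Sum>\<^sub>\<infinity>s\<in>{?x<..?y}. a s)"
    using infsetsum_infsum[OF abs] by (simp add: infsetsum_def)
  also have "\<dots> = S ?y - S ?x"
    using assms by (intro S_diff[symmetric]) auto
  also have "\<dots> = S y - S x"
    by (auto simp: max_def S_left)
  finally show ?thesis .
qed

text \<open>Both measures agree on half-open intervals, an intersection-stable generator of the
  Borel sets, and are finite on an exhausting sequence of them. This turns Stieltjes integrals into
  sums over jump times.\<close>

lemma interval_measure_S: "interval_measure S = atoms"
proof (rule measure_eqI_generator_eq)
  let ?E = "range (\<lambda>(x, y). {x<..y::real})"
  show "Int_stable ?E"
    by (auto simp: Int_stable_def)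
  show "?E \<subseteq> Pow UNIV" by auto
  show "sets (interval_measure S) = sigma_sets UNIV ?E" "sets atoms = sigma_sets UNIV ?E"
    unfolding atoms_def by (simp_all add: borel_sigma_sets_Ioc)
  show "emeasure (interval_measure S) A = emeasure atoms A" if "A \<in> ?E" for A
  proof -
    from that obtain x y where A: "A = {x<..y}" by auto
    show ?thesis
    proof (cases "x \<le> y")
      case True
      then show ?thesis unfolding A
        by (subst emeasure_interval_measure_Ioc) (auto simp: emeasure_atoms_Ioc S_mono S_right_cont)
    qed (simp add: A)
  qed
  show "range (\<lambda>i::nat. {-real i<..real i}) \<subseteq> ?E"
    by auto
  show "(\<Union>i::nat. {-real i<..real i}) = UNIV"
  proof safe
    fix x :: real
    obtain n :: nat where "\<bar>x\<bar> < real n" using reals_Archimedean2 by blast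
    then show "x \<in> (\<Union>i::nat. {-real i<..real i})" by (intro UN_I[of n]) auto
  qed auto
  show "emeasure (interval_measure S) {-real i<..real i} \<noteq> \<infinity>" for i :: nat
    by (subst emeasure_interval_measure_Ioc) (auto simp: S_mono S_right_cont)
qed

text \<open>A bounded function times summable weights is absolutely summable, so the Bochner
  integral against the counting measure and the unordered sum agree. Borel measurability of
  \<open>f\<close> enters in passing from \<open>atoms\<close> to the counting measure.\<close>

lemma stint_eq_infsum:
  assumes x: "c \<le> x"
    and f: "(\<lambda>u. indicator {x<..y} u * f u) \<in> borel_measurable borel"
    and B: "\<And>u. x < u \<Longrightarrow> u \<le> y \<Longrightarrow> \<bar>f u\<bar> \<le> B"
  shows "stint S {x<..y} f = (\<Sum>\<^sub>\<infinity>u\<in>{x<..y}. f u * a u)"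
    and "(\<lambda>u. f u * a u) summable_on {x<..y}"
proof -
  have abs: "Infinite_Set_Sum.abs_summable_on (\<lambda>u. f u * a u) {x<..y}"
  proof (rule abs_summable_on_comparison_test)
    show "Infinite_Set_Sum.abs_summable_on (\<lambda>u. B * a u) {x<..y}"
      using weight_summable_Ioc[OF x, of y]
      by (intro abs_summable_on_cmult_right)
         (simp add: abs_summable_equivalent[symmetric] weight_nonneg)
    show "norm (f u * a u) \<le> norm (B * a u)" if "u \<in> {x<..y}" for u
      using B[of u] that weight_nonneg[of u]
      by (auto simp: abs_mult intro!: mult_right_mono)
  qed
  show "(\<lambda>u. f u * a u) summable_on {x<..y}"
    by (rule abs_summable_summable[OF abs_summable_equivalent[THEN iffD2, OF abs]])
  have "stint S {x<..y} f = (\<integral>u. indicator {x<..y} u * f u \<partial>atoms)"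
    by (simp add: stint_def set_lebesgue_integral_def interval_measure_S)
  also have "\<dots> = (\<integral>u. indicator {x<..y} u * f u
      \<partial>density (count_space UNIV) (\<lambda>s. ennreal (indicator {c<..} s * a s)))"
    unfolding atoms_def by (rule integral_distr) (use f in auto)
  also have "\<dots> = (\<integral>u. (indicator {c<..} u * a u) * (indicator {x<..y} u * f u) \<partial>count_space UNIV)"
    by (subst integral_density) (auto simp: weight_nonneg)
  also have "\<dots> = (\<integral>u. indicator {x<..y} u *\<^sub>R (f u * a u) \<partial>count_space UNIV)"
    using x by (intro Bochner_Integration.integral_cong) (auto simp: indicator_def)
  also have "\<dots> = infsetsum (\<lambda>u. f u * a u) {x<..y}"
    by (simp add: infsetsum_altdef set_lebesgue_integral_def)
  also have "\<dots> = (\<Sum>\<^sub>\<infinity>u\<in>{x<..y}. f u * a u)"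
    by (rule infsetsum_infsum[OF abs])
  finally show "stint S {x<..y} f = (\<Sum>\<^sub>\<infinity>u\<in>{x<..y}. f u * a u)" .
qed

end

section \<open>Comparison of Stieltjes integrals for two families of jump weights\<close>

lemma
  fixes f g :: "'b \<Rightarrow> real"
  assumes f: "f summable_on A" and g: "g summable_on A"
  shows summable_on_diff: "(\<lambda>x. f x - g x) summable_on A"
    and infsum_diff: "(\<Sum>\<^sub>\<infinity>x\<in>A. f x - g x) = infsum f A - infsum g A"
proof -
  have g': "(\<lambda>x. - g x) summable_on A" using g by (simp add: summable_on_uminus)
  show "(\<lambda>x. f x - g x) summable_on A" "(\<Sum>\<^sub>\<infinity>x\<in>A. f x - g x) = infsum f A - infsum g A"
    using summable_on_add[OF f g'] infsum_add[OF f g'] by (simp_all add: infsum_uminus)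
qed

text \<open>Written as \<open>(f - g) b - g (a - b)\<close>, the difference charges the residual
  weights to \<open>g\<close> alone; \<open>Bf\<close> yields summability and is absent from the
  bound, so it may depend on \<open>n\<close> later. The shape
  \<open>\<alpha> + \<beta> * indicator {s<..} u\<close> separates the past up to \<open>s\<close>,
  already controlled, from the stretch after \<open>s\<close>, where only the mass beyond
  \<open>s\<close> multiplies \<open>\<beta>\<close>.\<close>

lemma stint_diff_bound:
  assumes A: "jump_weights c a" and B: "jump_weights c b" and ba: "\<And>s. b s \<le> a s"
    and xs: "c \<le> x" "x \<le> s" "s \<le> y"
    and mf: "(\<lambda>u. indicator {x<..y} u * f u) \<in> borel_measurable borel"
    and mg: "(\<lambda>u. indicator {x<..y} u * g u) \<in> borel_measurable borel"
    and Bf: "\<And>u. x < u \<Longrightarrow> u \<le> y \<Longrightarrow> \<bar>f u\<bar> \<le> Bf"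
    and Bg: "\<And>u. x < u \<Longrightarrow> u \<le> y \<Longrightarrow> \<bar>g u\<bar> \<le> Bg"
    and fg: "\<And>u. x < u \<Longrightarrow> u \<le> y \<Longrightarrow> \<bar>f u - g u\<bar> \<le> \<alpha> + \<beta> * indicator {s<..} u"
  shows "\<bar>stint (cumul c b) {x<..y} f - stint (cumul c a) {x<..y} g\<bar>
    \<le> \<alpha> * (cumul c a y - cumul c a x) + \<beta> * (cumul c a y - cumul c a s)
      + Bg * (\<Sum>\<^sub>\<infinity>u\<in>{x<..y}. a u - b u)"
proof -
  interpret A: jump_weights c a by fact
  interpret B: jump_weights c b by fact
  let ?I = "{x<..y}"
  let ?h = "\<lambda>u. \<alpha> * a u + (\<beta> * (indicator {s<..} u * a u) + Bg * (a u - b u))"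
  have f: "stint B.S ?I f = (\<Sum>\<^sub>\<infinity>u\<in>?I. f u * b u)" "(\<lambda>u. f u * b u) summable_on ?I"
    using Bf by (intro B.stint_eq_infsum[OF xs(1) mf]; blast)+
  have g: "stint A.S ?I g = (\<Sum>\<^sub>\<infinity>u\<in>?I. g u * a u)" "(\<lambda>u. g u * a u) summable_on ?I"
    using Bg by (intro A.stint_eq_infsum[OF xs(1) mg]; blast)+
  have sa: "a summable_on ?I" and sb: "b summable_on ?I"
    using A.weight_summable_Ioc B.weight_summable_Ioc xs by auto
  have sab: "(\<lambda>u. a u - b u) summable_on ?I"
    using summable_on_diff[OF sa sb] .
  have si: "(\<lambda>u. indicator {s<..} u * a u) summable_on ?I"
    by (rule summable_on_comparison_test[OF sa])
       (auto simp: indicator_def A.weight_nonneg)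
  have ii: "(\<Sum>\<^sub>\<infinity>u\<in>?I. indicator {s<..} u * a u) = (\<Sum>\<^sub>\<infinity>u\<in>{s<..y}. a u)"
    using xs by (intro infsum_cong_neutral) (auto simp: indicator_def)
  have sh: "?h summable_on ?I"
    by (intro summable_on_add summable_on_cmult_right sa sab si)
  have pw: "\<bar>f u * b u - g u * a u\<bar> \<le> ?h u" if "u \<in> ?I" for u
  proof -
    have "f u * b u - g u * a u = (f u - g u) * b u - g u * (a u - b u)"
      by (simp add: algebra_simps)
    also have "\<bar>\<dots>\<bar> \<le> \<bar>(f u - g u) * b u\<bar> + \<bar>g u * (a u - b u)\<bar>"
      by (rule abs_triangle_ineq4)
    also have "\<dots> \<le> (\<alpha> + \<beta> * indicator {s<..} u) * a u + Bg * (a u - b u)"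
    proof (rule add_mono)
      have fu: "\<bar>f u - g u\<bar> \<le> \<alpha> + \<beta> * indicator {s<..} u" using fg that by auto
      show "\<bar>(f u - g u) * b u\<bar> \<le> (\<alpha> + \<beta> * indicator {s<..} u) * a u"
        unfolding abs_mult using B.weight_nonneg[of u] ba[of u]
        by (intro mult_mono fu order_trans[OF abs_ge_zero fu]) auto
      show "\<bar>g u * (a u - b u)\<bar> \<le> Bg * (a u - b u)"
        using Bg[of u] that ba[of u] by (auto simp: abs_mult intro!: mult_right_mono)
    qed
    finally show ?thesis by (simp add: algebra_simps)
  qed
  have sd: "(\<lambda>u. f u * b u - g u * a u) summable_on ?I"
    by (rule summable_on_diff[OF f(2) g(2)])
  have "\<bar>stint (cumul c b) ?I f - stint (cumul c a) ?I g\<bar>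
      = \<bar>\<Sum>\<^sub>\<infinity>u\<in>?I. f u * b u - g u * a u\<bar>"
    unfolding f(1) g(1) by (simp add: infsum_diff[OF f(2) g(2)])
  also have "\<dots> \<le> (\<Sum>\<^sub>\<infinity>u\<in>?I. ?h u)"
  proof -
    have "(\<Sum>\<^sub>\<infinity>u\<in>?I. f u * b u - g u * a u) \<le> (\<Sum>\<^sub>\<infinity>u\<in>?I. ?h u)"
      by (intro infsum_mono sd sh) (use pw in \<open>auto simp: abs_le_iff\<close>)
    moreover have "(\<Sum>\<^sub>\<infinity>u\<in>?I. - (f u * b u - g u * a u)) \<le> (\<Sum>\<^sub>\<infinity>u\<in>?I. ?h u)"
      by (intro infsum_mono sh summable_on_uminus[THEN iffD2] sd)
         (use pw in \<open>auto simp: abs_le_iff\<close>)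
    ultimately show ?thesis
      by (simp only: infsum_uminus abs_le_iff)
  qed
  also have "\<dots> = \<alpha> * (\<Sum>\<^sub>\<infinity>u\<in>?I. a u) + (\<beta> * (\<Sum>\<^sub>\<infinity>u\<in>{s<..y}. a u)
      + Bg * (\<Sum>\<^sub>\<infinity>u\<in>?I. a u - b u))"
    unfolding ii[symmetric] infsum_cmult_right'[symmetric]
    by (subst infsum_add; (intro summable_on_add summable_on_cmult_right sa sab si)?)
       (subst infsum_add; (intro summable_on_add summable_on_cmult_right sa sab si refl)?)
  finally show ?thesis
    using A.S_diff[of x y] A.S_diff[of s y] xs by simp
qed

text \<open>Dominated convergence for series: on a finite set carrying almost all of the mass the
  weights eventually coincide, and off it the residual is at most \<open>a\<close>.\<close>

lemma residual_weights_tendsto_0: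
  assumes A: "jump_weights c a" and B: "\<And>n. jump_weights c (b n)" and ba: "\<And>n s. b n s \<le> a s"
    and ev: "\<And>s. \<forall>\<^sub>F n in sequentially. b n s = a s"
  shows "(\<lambda>n. \<Sum>\<^sub>\<infinity>u\<in>{c<..T}. a u - b n u) \<longlonglongrightarrow> 0"
proof (rule tendstoI)
  fix e :: real assume e: "0 < e"
  let ?I = "{c<..T}"
  interpret A: jump_weights c a by fact
  have sa: "a summable_on ?I" by (rule A.weight_summable)
  obtain J where J: "finite J" "J \<subseteq> ?I" "dist (sum a J) (infsum a ?I) \<le> e/2"
    using infsum_finite_approximation[OF sa, of "e/2"] e by auto
  have "\<forall>\<^sub>F n in sequentially. \<forall>s\<in>J. b n s = a s"
    using J ev by (simp add: eventually_ball_finite_distrib)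
  then show "\<forall>\<^sub>F n in sequentially. dist (\<Sum>\<^sub>\<infinity>u\<in>?I. a u - b n u) 0 < e"
  proof eventually_elim
    fix n assume n: "\<forall>s\<in>J. b n s = a s"
    interpret B: jump_weights c "b n" by fact
    have I: "?I = J \<union> (?I - J)" using J by auto
    have sr: "a summable_on (?I - J)" "b n summable_on (?I - J)"
      by (rule summable_on_subset[OF sa], simp, rule summable_on_subset[OF B.weight_summable[of T]], simp)
    have "(\<Sum>\<^sub>\<infinity>u\<in>?I. a u - b n u) = (\<Sum>\<^sub>\<infinity>u\<in>?I - J. a u - b n u)"
      using n by (intro infsum_cong_neutral) auto
    also have "\<dots> \<le> infsum a (?I - J)"
      using B.weight_nonneg by (intro infsum_mono summable_on_diff sr) auto
    also have "\<dots> = infsum a ?I - sum a J"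
      using infsum_Un_disjoint[of a J "?I - J"] sr J I by (simp add: Un_absorb1)
    also have "\<dots> < e"
      using J(3)[unfolded dist_real_def] e by linarith
    finally have "(\<Sum>\<^sub>\<infinity>u\<in>?I. a u - b n u) < e" .
    moreover have "0 \<le> (\<Sum>\<^sub>\<infinity>u\<in>?I. a u - b n u)"
      using ba by (intro infsum_nonneg) (auto simp: diff_ge_0_iff_ge)
    ultimately show "dist (\<Sum>\<^sub>\<infinity>u\<in>?I. a u - b n u) 0 < e" by simp
  qed
qed

section \<open>Lebesgue integrals over open intervals, the form in which the interval integrals of
  the equation are treated\<close>

lemma set_integrable_bounded_Ioo:
  fixes f :: "real \<Rightarrow> real"
  assumes "(\<lambda>u. indicator {x<..<y} u * f u) \<in> borel_measurable borel"
    and "\<And>u. x < u \<Longrightarrow> u < y \<Longrightarrow> \<bar>f u\<bar> \<le> B"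
  shows "set_integrable lborel {x<..<y} f"
  unfolding set_integrable_def
proof (rule Bochner_Integration.integrable_bound)
  show "integrable lborel (\<lambda>u. indicator {x<..<y} u *\<^sub>R B)"
    by (cases "x \<le> y") auto
  show "(\<lambda>u. indicator {x<..<y} u *\<^sub>R f u) \<in> borel_measurable lborel"
    using assms(1) by simp
qed (use assms(2) in \<open>force simp: indicator_def\<close>)

text \<open>The Lebesgue counterpart of the split at \<open>s\<close>. Here \<open>s\<close> itself
  belongs to the later part, because the drift at time \<open>s\<close> already involves the value
  of the path at \<open>s\<close>.\<close>

lemma abs_set_integral_Ioo_le:
  fixes f :: "real \<Rightarrow> real"
  assumes f: "set_integrable lborel {x<..<y} f" and xs: "x \<le> s" "s \<le> y" and "0 \<le> \<beta>"
    and fb: "\<And>u. x < u \<Longrightarrow> u < y \<Longrightarrow> \<bar>f u\<bar> \<le> \<alpha> + \<beta> * indicator {s..} u"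
  shows "\<bar>LINT u:{x<..<y}|lborel. f u\<bar> \<le> \<alpha> * (y - x) + \<beta> * (y - s)"
proof -
  let ?h = "\<lambda>u. \<alpha> * indicator {x<..<y} u + \<beta> * indicator {s..y} u :: real"
  have h: "integrable lborel ?h"
    using xs by (intro Bochner_Integration.integrable_add integrable_mult_right) auto
  have "\<bar>LINT u:{x<..<y}|lborel. f u\<bar> \<le> (\<integral>u. \<bar>indicator {x<..<y} u * f u\<bar> \<partial>lborel)"
    unfolding set_lebesgue_integral_def
    using integral_norm_bound[of lborel "\<lambda>u. indicator {x<..<y} u * f u"] by simp
  also have "\<dots> \<le> (\<integral>u. ?h u \<partial>lborel)"
  proof (rule integral_mono[OF _ h])
    show "integrable lborel (\<lambda>u. \<bar>indicator {x<..<y} u * f u\<bar>)"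
      using f unfolding set_integrable_def by (intro integrable_abs) simp
    show "\<bar>indicator {x<..<y} u * f u\<bar> \<le> ?h u" for u
      using fb[of u] \<open>0 \<le> \<beta>\<close> by (auto simp: indicator_def split: if_splits)
  qed
  also have "\<dots> = \<alpha> * (y - x) + \<beta> * (y - s)"
    using xs by (subst Bochner_Integration.integral_add) auto
  finally show ?thesis .
qed

section \<open>The delay equation along a path\<close>

locale delay_kernel =
  fixes p q r \<eta> c\<^sub>\<mu> c\<^sub>\<nu> C\<^sub>\<mu> C\<^sub>\<nu> :: real and f\<^sub>\<mu> f\<^sub>\<nu> :: "real \<Rightarrow> real"
  assumes pq: "0 \<le> p" "0 \<le> q" "r = max p q"
    and c_nonneg: "0 \<le> c\<^sub>\<mu>" "0 \<le> c\<^sub>\<nu>"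
    and f_cont: "continuous_on UNIV f\<^sub>\<mu>" "continuous_on UNIV f\<^sub>\<nu>"
    and f_le: "\<And>x. \<bar>f\<^sub>\<mu> x\<bar> \<le> C\<^sub>\<mu>" "\<And>x. \<bar>f\<^sub>\<nu> x\<bar> \<le> C\<^sub>\<nu>"
begin

lemma f_measurable [measurable]: "f\<^sub>\<mu> \<in> borel_measurable borel" "f\<^sub>\<nu> \<in> borel_measurable borel"
  using f_cont by (auto intro: borel_measurable_continuous_onI)

lemma C_nonneg: "0 \<le> C\<^sub>\<mu>" "0 \<le> C\<^sub>\<nu>"
  using order_trans[OF abs_ge_zero f_le(1)] order_trans[OF abs_ge_zero f_le(2)] by auto

lemma memory_le: "0 \<le> v \<Longrightarrow> - r \<le> v - p" "0 \<le> v \<Longrightarrow> - r \<le> v - q" "- r \<le> 0"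
  using pq by auto

lemma lebesgue_memory:
  assumes H: "cadlag_from (- r) H" and v: "0 \<le> v"
    and B: "\<And>u. - r \<le> u \<Longrightarrow> u \<le> v \<Longrightarrow> \<bar>H u\<bar> \<le> B"
  shows "set_integrable lborel {v - p<..<v} (\<lambda>u. f\<^sub>\<mu> (u - v) * H u)"
    and "\<bar>LINT u:{v - p<..<v}|lborel. f\<^sub>\<mu> (u - v) * H u\<bar> \<le> p * C\<^sub>\<mu> * B"
proof -
  have bd: "\<bar>f\<^sub>\<mu> (u - v) * H u\<bar> \<le> C\<^sub>\<mu> * B" if "v - p < u" "u < v" for u
    unfolding abs_mult using B[of u] that memory_le(1)[OF v] C_nonneg by (intro mult_mono f_le) auto
  have "(\<lambda>u. indicator {v - p<..<v} u * (f\<^sub>\<mu> (u - v) * H u))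
      = (\<lambda>u. indicator {v - p<..<v} u * f\<^sub>\<mu> (u - v) * (indicator {- r..} u * H u))"
    using memory_le(1)[OF v] by (auto simp: indicator_def fun_eq_iff)
  also have "\<dots> \<in> borel_measurable borel"
    by (rule borel_measurable_times[OF _ borel_measurable_cadlag_from[OF H]]) measurable
  finally show int: "set_integrable lborel {v - p<..<v} (\<lambda>u. f\<^sub>\<mu> (u - v) * H u)"
    using bd by (rule set_integrable_bounded_Ioo)
  show "\<bar>LINT u:{v - p<..<v}|lborel. f\<^sub>\<mu> (u - v) * H u\<bar> \<le> p * C\<^sub>\<mu> * B"
    using abs_set_integral_Ioo_le[OF int, where s=v and \<alpha>="C\<^sub>\<mu> * B" and \<beta>=0] bd pq by (simp add: mult_ac)
qed

lemma jump_memory_measurable: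
  assumes H: "cadlag_from (- r) H" and x: "- r \<le> x" and f: "f \<in> borel_measurable borel"
  shows "(\<lambda>u. indicator {x<..y} u * (f u * lft H u)) \<in> borel_measurable borel"
proof -
  have "(\<lambda>u. indicator {x<..y} u * (f u * lft H u))
      = (\<lambda>u. indicator {x<..y} u * f u * (indicator {- r<..} u * lft H u))"
    using x by (auto simp: indicator_def fun_eq_iff)
  also have "\<dots> \<in> borel_measurable borel"
    by (rule borel_measurable_times[OF _ borel_measurable_lft[OF H]]) (use f in measurable)
  finally show ?thesis .
qed

lemma drift_eq:
  "drift \<eta> c\<^sub>\<mu> f\<^sub>\<mu> f\<^sub>\<nu> p q S H v = \<eta> - c\<^sub>\<mu> * H v + (LINT u:{v - p<..<v}|lborel. f\<^sub>\<mu> (u - v) * H u)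
     + stint S {v-q<..v} (\<lambda>u. f\<^sub>\<nu> (u - v) * lft H u)"
  unfolding drift_def using pq by (simp add: interval_integral_Ioo)

text \<open>Integrals depending on a parameter are measurable when the integrand is jointly
  measurable and the measure is sigma-finite. To reach that form, the moving window goes into the
  integrand as a condition on \<open>(v, u)\<close>, and the path is cut off where it is
  arbitrary.\<close>

lemma drift_measurable:
  assumes A: "jump_weights (- r) a" and H: "cadlag_from (- r) H"
  shows "(\<lambda>v. indicator {0<..<T} v * drift \<eta> c\<^sub>\<mu> f\<^sub>\<mu> f\<^sub>\<nu> p q (cumul (- r) a) H v) \<in> borel_measurable borel"
proof -
  interpret A: jump_weights "- r" a by fact
  interpret I: sigma_finite_measure "interval_measure A.S"
    by (intro sigma_finite_interval_measure A.S_mono A.S_right_cont)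
  let ?H = "\<lambda>u. indicator {- r..} u * H u" and ?G = "\<lambda>u. indicator {- r<..} u * lft H u"
  note [measurable] = borel_measurable_cadlag_from[OF H] borel_measurable_lft[OF H]
  let ?A = "\<lambda>v. \<integral>u. (if v - p < u \<and> u < v then f\<^sub>\<mu> (u - v) * ?H u else 0) \<partial>lborel"
  let ?B = "\<lambda>v. \<integral>u. (if v - q < u \<and> u \<le> v then f\<^sub>\<nu> (u - v) * ?G u else 0) \<partial>interval_measure A.S"
  have "?A \<in> borel_measurable borel" "?B \<in> borel_measurable borel"
    by (rule lborel.borel_measurable_lebesgue_integral I.borel_measurable_lebesgue_integral; measurable)+
  then have "(\<lambda>v. indicator {0<..<T} v * (\<eta> - c\<^sub>\<mu> * ?H v + ?A v + ?B v)) \<in> borel_measurable borel"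
    by (intro borel_measurable_times[OF _ borel_measurable_add] borel_measurable_add
        borel_measurable_diff borel_measurable_times[OF _ borel_measurable_cadlag_from[OF H]]) auto
  also have "(\<lambda>v. indicator {0<..<T} v * (\<eta> - c\<^sub>\<mu> * ?H v + ?A v + ?B v))
    = (\<lambda>v. indicator {0<..<T} v * drift \<eta> c\<^sub>\<mu> f\<^sub>\<mu> f\<^sub>\<nu> p q A.S H v)"
  proof
    fix v
    show "indicator {0<..<T} v * (\<eta> - c\<^sub>\<mu> * ?H v + ?A v + ?B v)
      = indicator {0<..<T} v * drift \<eta> c\<^sub>\<mu> f\<^sub>\<mu> f\<^sub>\<nu> p q A.S H v"
    proof (cases "0 < v")
      case True
      have "?A v = (LINT u:{v - p<..<v}|lborel. f\<^sub>\<mu> (u - v) * H u)"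
        unfolding set_lebesgue_integral_def using memory_le(1)[of v] True
        by (intro Bochner_Integration.integral_cong) (auto simp: indicator_def)
      moreover have "?B v = stint A.S {v-q<..v} (\<lambda>u. f\<^sub>\<nu> (u - v) * lft H u)"
        unfolding set_lebesgue_integral_def stint_def using memory_le(2)[of v] True
        by (intro Bochner_Integration.integral_cong) (auto simp: indicator_def)
      moreover have "?H v = H v" using memory_le(3) True by (auto simp: indicator_def)
      ultimately show ?thesis by (simp add: drift_eq)
    qed (simp add: indicator_def)
  qed
  finally show ?thesis .
qed

text \<open>The drift is Lipschitz in the running supremum: the three summands of the constant stem
  from the linear term, the Lebesgue memory and the jump memory. The bound \<open>g\<close> must
  hold up to and including \<open>v\<close>, since the linear term reads the path at
  \<open>v\<close>. The residual weights are again paid for by \<open>Bx\<close> alone.\<close>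

lemma drift_diff_bound:
  assumes A: "jump_weights (- r) a" and B: "jump_weights (- r) b" and ba: "\<And>s. b s \<le> a s"
    and x: "cadlag_from (- r) x" and y: "cadlag_from (- r) y"
    and v: "0 \<le> v" "v \<le> T"
    and Bx: "\<And>u. - r \<le> u \<Longrightarrow> u \<le> T \<Longrightarrow> \<bar>x u\<bar> \<le> Bx"
    and g: "\<And>u. - r \<le> u \<Longrightarrow> u \<le> v \<Longrightarrow> \<bar>y u - x u\<bar> \<le> g"
  shows "\<bar>drift \<eta> c\<^sub>\<mu> f\<^sub>\<mu> f\<^sub>\<nu> p q (cumul (- r) b) y v - drift \<eta> c\<^sub>\<mu> f\<^sub>\<mu> f\<^sub>\<nu> p q (cumul (- r) a) x v\<bar>
    \<le> (c\<^sub>\<mu> + p * C\<^sub>\<mu> + C\<^sub>\<nu> * cumul (- r) a T) * g + C\<^sub>\<nu> * Bx * (\<Sum>\<^sub>\<infinity>u\<in>{- r<..T}. a u - b u)"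
proof -
  interpret A: jump_weights "- r" a by fact
  interpret B: jump_weights "- r" b by fact
  note m = memory_le(1,2)[OF v(1)] memory_le(3)
  have "0 \<le> \<bar>x v\<bar>" "0 \<le> \<bar>y v - x v\<bar>" by simp_all
  then have Bx0: "0 \<le> Bx" and g0: "0 \<le> g"
    using Bx[of v] g[of v] v m by linarith+
  obtain By where By: "\<And>u. - r \<le> u \<Longrightarrow> u \<le> v \<Longrightarrow> \<bar>y u\<bar> \<le> By"
    using cadlag_from_bounded[OF y] by metis
  have Bx': "\<bar>x u\<bar> \<le> Bx" if "- r \<le> u" "u \<le> v" for u using Bx that v by auto
  have lx: "\<bar>lft x u\<bar> \<le> Bx" and ly: "\<bar>lft y u\<bar> \<le> By" and lyx: "\<bar>lft y u - lft x u\<bar> \<le> g"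
    if "v - q < u" "u \<le> v" for u
  proof -
    have u: "- r < u" using that m by auto
    show "\<bar>lft x u\<bar> \<le> Bx" "\<bar>lft y u\<bar> \<le> By"
      using that by (auto intro!: abs_lft_le[OF x u] abs_lft_le[OF y u] Bx' By)
    show "\<bar>lft y u - lft x u\<bar> \<le> g"
      using that abs_lft_le[OF cadlag_from_diff[OF y x] u, of g] lft_diff[OF y x u] g by auto
  qed
  have 1: "\<bar>(LINT u:{v - p<..<v}|lborel. f\<^sub>\<mu> (u - v) * y u) - (LINT u:{v - p<..<v}|lborel. f\<^sub>\<mu> (u - v) * x u)\<bar>
      \<le> p * C\<^sub>\<mu> * g"
  proof -
    have "set_integrable lborel {v - p<..<v} (\<lambda>u. f\<^sub>\<mu> (u - v) * y u)"
      "set_integrable lborel {v - p<..<v} (\<lambda>u. f\<^sub>\<mu> (u - v) * x u)"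
      using By Bx' by (blast intro: lebesgue_memory(1)[OF y v(1)] lebesgue_memory(1)[OF x v(1)])+
    moreover have "\<bar>LINT u:{v - p<..<v}|lborel. f\<^sub>\<mu> (u - v) * (y u - x u)\<bar> \<le> p * C\<^sub>\<mu> * g"
      using g by (intro lebesgue_memory(2)[OF cadlag_from_diff[OF y x] v(1)]) auto
    ultimately show ?thesis
      by (simp add: right_diff_distrib set_integral_diff(2))
  qed
  \<comment> \<open>One bound \<open>g\<close> covers the whole memory window, so the split of the
    comparison lemma is used with \<open>\<beta> = 0\<close>.\<close>
  have "\<bar>stint B.S {v-q<..v} (\<lambda>u. f\<^sub>\<nu> (u - v) * lft y u) - stint A.S {v-q<..v} (\<lambda>u. f\<^sub>\<nu> (u - v) * lft x u)\<bar>
      \<le> (C\<^sub>\<nu> * g) * (A.S v - A.S (v - q)) + 0 * (A.S v - A.S v)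
        + (C\<^sub>\<nu> * Bx) * (\<Sum>\<^sub>\<infinity>u\<in>{v-q<..v}. a u - b u)"
  proof (rule stint_diff_bound[OF A B ba m(2)])
    show "v - q \<le> v" "v \<le> v" using pq by auto
    show "(\<lambda>u. indicator {v-q<..v} u * (f\<^sub>\<nu> (u - v) * lft y u)) \<in> borel_measurable borel"
      "(\<lambda>u. indicator {v-q<..v} u * (f\<^sub>\<nu> (u - v) * lft x u)) \<in> borel_measurable borel"
      by (intro jump_memory_measurable x y m; measurable)+
    fix u assume u: "v - q < u" "u \<le> v"
    show "\<bar>f\<^sub>\<nu> (u - v) * lft y u\<bar> \<le> C\<^sub>\<nu> * By" "\<bar>f\<^sub>\<nu> (u - v) * lft x u\<bar> \<le> C\<^sub>\<nu> * Bx"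
      unfolding abs_mult using u C_nonneg by (auto intro!: mult_mono f_le lx ly)
    have "\<bar>f\<^sub>\<nu> (u - v) * (lft y u - lft x u)\<bar> \<le> C\<^sub>\<nu> * g"
      unfolding abs_mult using u C_nonneg by (auto intro!: mult_mono f_le lyx)
    then show "\<bar>f\<^sub>\<nu> (u - v) * lft y u - f\<^sub>\<nu> (u - v) * lft x u\<bar> \<le> C\<^sub>\<nu> * g + 0 * indicator {v<..} u"
      by (simp add: right_diff_distrib)
  qed
  also have "\<dots> \<le> (C\<^sub>\<nu> * g) * A.S T + (C\<^sub>\<nu> * Bx) * (\<Sum>\<^sub>\<infinity>u\<in>{-r<..T}. a u - b u)"
  proof -
    have "A.S v - A.S (v - q) \<le> A.S T"
      using A.S_mono[OF v(2)] A.S_nonneg[of "v - q"] by linarith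
    moreover have "(\<Sum>\<^sub>\<infinity>u\<in>{v-q<..v}. a u - b u) \<le> (\<Sum>\<^sub>\<infinity>u\<in>{-r<..T}. a u - b u)"
      using m v ba
      by (intro infsum_mono2 summable_on_diff A.weight_summable_Ioc B.weight_summable_Ioc) auto
    ultimately show ?thesis
      using C_nonneg g0 Bx0 by (auto intro!: add_mono mult_left_mono)
  qed
  finally have 2: "\<bar>stint B.S {v-q<..v} (\<lambda>u. f\<^sub>\<nu> (u - v) * lft y u)
      - stint A.S {v-q<..v} (\<lambda>u. f\<^sub>\<nu> (u - v) * lft x u)\<bar>
      \<le> (C\<^sub>\<nu> * g) * A.S T + (C\<^sub>\<nu> * Bx) * (\<Sum>\<^sub>\<infinity>u\<in>{-r<..T}. a u - b u)" .
  have 3: "\<bar>c\<^sub>\<mu> * (y v - x v)\<bar> \<le> c\<^sub>\<mu> * g"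
    unfolding abs_mult using c_nonneg g[of v] v m by (auto intro!: mult_left_mono)
  have eq: "(\<eta> - c\<^sub>\<mu> * y v + A1 + B1) - (\<eta> - c\<^sub>\<mu> * x v + A2 + B2)
      = (A1 - A2) + (B1 - B2) - c\<^sub>\<mu> * (y v - x v)" for A1 A2 B1 B2
    by (simp add: algebra_simps)
  have "\<bar>drift \<eta> c\<^sub>\<mu> f\<^sub>\<mu> f\<^sub>\<nu> p q B.S y v - drift \<eta> c\<^sub>\<mu> f\<^sub>\<mu> f\<^sub>\<nu> p q A.S x v\<bar>
      \<le> p * C\<^sub>\<mu> * g + (C\<^sub>\<nu> * g * A.S T + C\<^sub>\<nu> * Bx * (\<Sum>\<^sub>\<infinity>u\<in>{-r<..T}. a u - b u)) + c\<^sub>\<mu> * g"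
    unfolding drift_eq eq using 1 2 3 by linarith
  then show ?thesis
    by (simp add: algebra_simps)
qed

text \<open>The difference bound is applied with equal weights to \<open>x\<close> and the zero
  path: the residual vanishes and the drift of the zero path is \<open>\<eta>\<close>.\<close>

lemma drift_bounded:
  assumes A: "jump_weights (- r) a" and x: "cadlag_from (- r) x"
  obtains B where "\<And>v. 0 \<le> v \<Longrightarrow> v \<le> T \<Longrightarrow> \<bar>drift \<eta> c\<^sub>\<mu> f\<^sub>\<mu> f\<^sub>\<nu> p q (cumul (- r) a) x v\<bar> \<le> B"
proof -
  obtain Bx where Bx: "\<And>u. - r \<le> u \<Longrightarrow> u \<le> T \<Longrightarrow> \<bar>x u\<bar> \<le> Bx"
    using cadlag_from_bounded[OF x] by metis
  have z: "cadlag_from (- r) (\<lambda>_. 0)" by (auto simp: cadlag_from_def)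
  have [simp]: "lft (\<lambda>_. 0) u = 0" for u
    unfolding lft_def by (intro tendsto_Lim) auto
  have [simp]: "drift \<eta> c\<^sub>\<mu> f\<^sub>\<mu> f\<^sub>\<nu> p q S (\<lambda>_. 0) v = \<eta>" for S v
    by (simp add: drift_eq stint_def)
  have "\<bar>drift \<eta> c\<^sub>\<mu> f\<^sub>\<mu> f\<^sub>\<nu> p q (cumul (- r) a) x v\<bar>
      \<le> \<bar>\<eta>\<bar> + (c\<^sub>\<mu> + p * C\<^sub>\<mu> + C\<^sub>\<nu> * cumul (- r) a T) * Bx" if "0 \<le> v" "v \<le> T" for v
    using drift_diff_bound[OF A A order_refl z x that, of 0 Bx] Bx that by fastforce
  then show thesis by (rule that)
qed

lemma drift_integrable:
  assumes "jump_weights (- r) a" "cadlag_from (- r) x"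
  shows "set_integrable lborel {0<..<t} (drift \<eta> c\<^sub>\<mu> f\<^sub>\<mu> f\<^sub>\<nu> p q (cumul (- r) a) x)"
proof -
  obtain B where "\<And>v. 0 \<le> v \<Longrightarrow> v \<le> t \<Longrightarrow> \<bar>drift \<eta> c\<^sub>\<mu> f\<^sub>\<mu> f\<^sub>\<nu> p q (cumul (- r) a) x v\<bar> \<le> B"
    using drift_bounded[OF assms] by metis
  then show ?thesis
    by (intro set_integrable_bounded_Ioo[where B=B] drift_measurable assms) auto
qed

text \<open>Only the evolution after time 0 is recorded, with \<open>\<phi>\<close> as value at 0.
  The initial segment enters through the separate requirement that the compared paths agree on
  \<open>[-r, 0]\<close>.\<close>

definition solves :: "(real \<Rightarrow> real) \<Rightarrow> real \<Rightarrow> (real \<Rightarrow> real) \<Rightarrow> bool" where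
  "solves a \<phi> x \<longleftrightarrow> cadlag_from (- r) x \<and>
     (\<forall>t\<ge>0. x t = \<phi> + (LBINT s=0..t. drift \<eta> c\<^sub>\<mu> f\<^sub>\<mu> f\<^sub>\<nu> p q (cumul (- r) a) x s)
        + c\<^sub>\<nu> * stint (cumul (- r) a) {0<..t} (lft x))"

text \<open>The coefficient of \<open>G\<^sub>s\<close> may be large, which is harmless as
  \<open>G\<^sub>s\<close> will already tend to 0. The coefficient of \<open>G\<^sub>t\<close> is
  made of the length and the mass of the stretch after \<open>s\<close>, so it is small on suitable
  intervals and can be absorbed. Because \<open>t' < t\<close>, the mass \<open>\<delta>\<close>
  need not include an atom at \<open>t\<close>.\<close>

lemma solution_diff_step:
  assumes A: "jump_weights (- r) a" and B: "jump_weights (- r) b" and ba: "\<And>s. b s \<le> a s"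
    and x: "solves a \<phi> x" and y: "solves b \<phi> y"
    and Bx: "\<And>u. - r \<le> u \<Longrightarrow> u \<le> T \<Longrightarrow> \<bar>x u\<bar> \<le> Bx"
    and st: "0 \<le> s" "s \<le> t'" "t' < t" "t \<le> T"
    and Gs: "0 \<le> G\<^sub>s" "\<And>u. - r \<le> u \<Longrightarrow> u < s \<Longrightarrow> \<bar>y u - x u\<bar> \<le> G\<^sub>s"
    and Gt: "0 \<le> G\<^sub>t" "\<And>u. - r \<le> u \<Longrightarrow> u < t \<Longrightarrow> \<bar>y u - x u\<bar> \<le> G\<^sub>t"
    and \<delta>: "cumul (- r) a t' - cumul (- r) a s \<le> \<delta>"
  defines "K \<equiv> c\<^sub>\<mu> + p * C\<^sub>\<mu> + C\<^sub>\<nu> * cumul (- r) a T"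
  shows "\<bar>y t' - x t'\<bar> \<le> (T * C\<^sub>\<nu> + c\<^sub>\<nu>) * Bx * (\<Sum>\<^sub>\<infinity>u\<in>{- r<..T}. a u - b u)
    + (K * T + c\<^sub>\<nu> * cumul (- r) a T) * G\<^sub>s + (K * (t - s) + c\<^sub>\<nu> * \<delta>) * G\<^sub>t"
proof -
  interpret A: jump_weights "- r" a by fact
  interpret B: jump_weights "- r" b by fact
  have cx: "cadlag_from (- r) x" and cy: "cadlag_from (- r) y"
    using x y by (auto simp: solves_def)
  define R where "R = (\<Sum>\<^sub>\<infinity>u\<in>{- r<..T}. a u - b u)"
  have R0: "0 \<le> R" unfolding R_def using ba by (intro infsum_nonneg) (simp add: diff_ge_0_iff_ge)
  have K0: "0 \<le> K"
    unfolding K_def using c_nonneg C_nonneg pq A.S_nonneg by (intro add_nonneg_nonneg mult_nonneg_nonneg) auto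
  have "0 \<le> \<bar>x 0\<bar>" by simp
  then have Bx0: "0 \<le> Bx" using Bx[of 0] memory_le(3) st by linarith
  have t0: "0 \<le> t'" using st by simp
  let ?bx = "drift \<eta> c\<^sub>\<mu> f\<^sub>\<mu> f\<^sub>\<nu> p q A.S x" and ?by = "drift \<eta> c\<^sub>\<mu> f\<^sub>\<mu> f\<^sub>\<nu> p q B.S y"
  have ix: "set_integrable lborel {0<..<t'} ?bx" and iy: "set_integrable lborel {0<..<t'} ?by"
    by (intro drift_integrable A B cx cy)+
  have ex: "x t' = \<phi> + (LINT v:{0<..<t'}|lborel. ?bx v) + c\<^sub>\<nu> * stint A.S {0<..t'} (lft x)"
    using x t0 by (auto simp: solves_def interval_integral_Ioo zero_ereal_def)
  have ey: "y t' = \<phi> + (LINT v:{0<..<t'}|lborel. ?by v) + c\<^sub>\<nu> * stint B.S {0<..t'} (lft y)"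
    using y t0 by (auto simp: solves_def interval_integral_Ioo zero_ereal_def)
  have "\<bar>LINT v:{0<..<t'}|lborel. ?by v - ?bx v\<bar>
      \<le> (K * G\<^sub>s + C\<^sub>\<nu> * Bx * R) * (t' - 0) + (K * G\<^sub>t) * (t' - s)"
  proof (rule abs_set_integral_Ioo_le)
    show "set_integrable lborel {0<..<t'} (\<lambda>v. ?by v - ?bx v)"
      by (rule set_integral_diff(1)[OF iy ix])
    show "0 \<le> K * G\<^sub>t" using K0 Gt by simp
    fix v assume v: "0 < v" "v < t'"
    have *: "\<bar>?by v - ?bx v\<bar> \<le> K * g + C\<^sub>\<nu> * Bx * R"
      if "\<And>u. - r \<le> u \<Longrightarrow> u \<le> v \<Longrightarrow> \<bar>y u - x u\<bar> \<le> g" for g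
      unfolding K_def R_def using v st that by (intro drift_diff_bound[OF A B ba cx cy _ _ Bx]) auto
    show "\<bar>?by v - ?bx v\<bar> \<le> (K * G\<^sub>s + C\<^sub>\<nu> * Bx * R) + (K * G\<^sub>t) * indicator {s..} v"
    \<comment> \<open>At \<open>v = s\<close> the drift reads the paths at \<open>s\<close>, which
      \<open>G\<^sub>s\<close> does not control; this time falls into the second case.\<close>
    proof (cases "v < s")
      case True
      then show ?thesis using *[of G\<^sub>s] Gs by (auto simp: indicator_def)
    next
      case False
      have "0 \<le> K * G\<^sub>s" using K0 Gs by simp
      then show ?thesis using False *[of G\<^sub>t] Gt v st by (auto simp: indicator_def)
    qed
  qed (use st in auto)
  also have "\<dots> \<le> (K * G\<^sub>s + C\<^sub>\<nu> * Bx * R) * T + (K * G\<^sub>t) * (t - s)"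
    using st K0 Gs Gt C_nonneg Bx0 R0 by (intro add_mono mult_left_mono) auto
  finally have 1: "\<bar>(LINT v:{0<..<t'}|lborel. ?by v) - (LINT v:{0<..<t'}|lborel. ?bx v)\<bar>
      \<le> (K * G\<^sub>s + C\<^sub>\<nu> * Bx * R) * T + (K * G\<^sub>t) * (t - s)"
    by (simp add: set_integral_diff(2)[OF iy ix])
  \<comment> \<open>This bound depends on the approximating path, and disappears from the estimate
    that follows.\<close>
  obtain By where By: "\<And>u. - r \<le> u \<Longrightarrow> u \<le> t \<Longrightarrow> \<bar>y u\<bar> \<le> By"
    using cadlag_from_bounded[OF cy] by metis
  have "\<bar>stint B.S {0<..t'} (lft y) - stint A.S {0<..t'} (lft x)\<bar>
      \<le> G\<^sub>s * (A.S t' - A.S 0) + G\<^sub>t * (A.S t' - A.S s) + Bx * (\<Sum>\<^sub>\<infinity>u\<in>{0<..t'}. a u - b u)"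
  proof (rule stint_diff_bound[OF A B ba memory_le(3)])
    show "0 \<le> s" "s \<le> t'" using st by auto
    show "(\<lambda>u. indicator {0<..t'} u * lft y u) \<in> borel_measurable borel"
      "(\<lambda>u. indicator {0<..t'} u * lft x u) \<in> borel_measurable borel"
      using jump_memory_measurable[OF cy memory_le(3), of "\<lambda>_. 1"]
        jump_memory_measurable[OF cx memory_le(3), of "\<lambda>_. 1"] by auto
    fix u assume u: "0 < u" "u \<le> t'"
    then have ru: "- r < u" using memory_le(3) by linarith
    show "\<bar>lft y u\<bar> \<le> By" "\<bar>lft x u\<bar> \<le> Bx"
      using u st by (auto intro!: abs_lft_le[OF cx ru] abs_lft_le[OF cy ru] Bx By)
    have *: "\<bar>lft y u - lft x u\<bar> \<le> g" if "\<And>v. - r \<le> v \<Longrightarrow> v < u \<Longrightarrow> \<bar>y v - x v\<bar> \<le> g" for g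
      using abs_lft_le[OF cadlag_from_diff[OF cy cx] ru, of g] lft_diff[OF cy cx ru] that by auto
    show "\<bar>lft y u - lft x u\<bar> \<le> G\<^sub>s + G\<^sub>t * indicator {s<..} u"
    \<comment> \<open>The left limit at \<open>u = s\<close> sees only times before
      \<open>s\<close>, so an atom at \<open>s\<close> is weighted by
      \<open>G\<^sub>s\<close>.\<close>
    proof (cases "u \<le> s")
      case True
      then show ?thesis using *[of G\<^sub>s] Gs by (auto simp: indicator_def)
    next
      case False
      then show ?thesis using *[of G\<^sub>t] Gt Gs u st by (fastforce simp: indicator_def)
    qed
  qed
  also have "\<dots> \<le> G\<^sub>s * A.S T + G\<^sub>t * \<delta> + Bx * R"
  proof -
    have "A.S t' - A.S 0 \<le> A.S T"
      using A.S_mono[of t' T] A.S_nonneg[of 0] st by linarith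
    moreover have "(\<Sum>\<^sub>\<infinity>u\<in>{0<..t'}. a u - b u) \<le> R"
      unfolding R_def using memory_le(3) st ba
      by (intro infsum_mono2 summable_on_diff A.weight_summable_Ioc B.weight_summable_Ioc) auto
    ultimately show ?thesis
      using \<delta> Gs Gt Bx0 by (intro add_mono mult_left_mono) auto
  qed
  finally have "\<bar>c\<^sub>\<nu> * (stint B.S {0<..t'} (lft y) - stint A.S {0<..t'} (lft x))\<bar>
      \<le> c\<^sub>\<nu> * (G\<^sub>s * A.S T + G\<^sub>t * \<delta> + Bx * R)"
    unfolding abs_mult using c_nonneg by (auto intro!: mult_left_mono)
  moreover have "y t' - x t' = ((LINT v:{0<..<t'}|lborel. ?by v) - (LINT v:{0<..<t'}|lborel. ?bx v))
      + c\<^sub>\<nu> * (stint B.S {0<..t'} (lft y) - stint A.S {0<..t'} (lft x))"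
    unfolding ex ey by (simp add: algebra_simps)
  ultimately have "\<bar>y t' - x t'\<bar> \<le> ((K * G\<^sub>s + C\<^sub>\<nu> * Bx * R) * T + (K * G\<^sub>t) * (t - s))
      + c\<^sub>\<nu> * (G\<^sub>s * A.S T + G\<^sub>t * \<delta> + Bx * R)"
    using 1 by linarith
  then show ?thesis
    unfolding R_def[symmetric] by (simp add: algebra_simps)
qed

end

text \<open>\<open>S\<close> is monotone and bounded on \<open>{..<x}\<close>, so it has a finite
  limit there. The restriction \<open>t < x\<close> excludes the atom at \<open>x\<close>, whose
  size is not controlled.\<close>

lemma (in jump_weights) S_left_small:
  assumes "0 < \<delta>"
  obtains s\<^sub>0 where "s\<^sub>0 < x" "\<And>s t. s\<^sub>0 \<le> s \<Longrightarrow> t < x \<Longrightarrow> S t - S s \<le> \<delta>"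
proof -
  have bdd: "bdd_above (S ` {..<x})"
    using S_mono by (intro bdd_aboveI[of _ "S x"]) auto
  have ne: "S ` {..<x} \<noteq> {}" by (simp add: lt_ex)
  obtain s\<^sub>0 where s\<^sub>0: "s\<^sub>0 < x" "Sup (S ` {..<x}) - \<delta> < S s\<^sub>0"
    using less_cSupE[OF _ ne, of "Sup (S ` {..<x}) - \<delta>"] assms by auto
  have "S t - S s \<le> \<delta>" if "s\<^sub>0 \<le> s" "t < x" for s t
  proof -
    have "S t \<le> Sup (S ` {..<x})" using that bdd by (intro cSup_upper) auto
    then show ?thesis using s\<^sub>0(2) S_mono[OF that(1)] by linarith
  qed
  with s\<^sub>0(1) show thesis by (rule that)
qed

context delay_kernel
begin

text \<open>Gronwall's argument by bisection: if the interval is short and the open interval carries little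
  mass of the driving measure, smallness of the difference propagates from its left to its right end.
  Since the suprema \<open>G\<close> are over half-open intervals, the atom at the right end does not enter.\<close>

theorem solutions_converge:
  assumes A: "jump_weights (- r) a" and B: "\<And>n. jump_weights (- r) (b n)"
    and ba: "\<And>n s. b n s \<le> a s" and ev: "\<And>s. \<forall>\<^sub>F n in sequentially. b n s = a s"
    and x: "solves a \<phi> x" and y: "\<And>n. solves (b n) \<phi> (y n)"
    and init: "\<And>n t. - r \<le> t \<Longrightarrow> t \<le> 0 \<Longrightarrow> y n t = x t"
    and T: "0 \<le> T"
  shows "(\<lambda>n. SUP s\<in>{- r..T}. \<bar>y n s - x s\<bar>) \<longlonglongrightarrow> 0"
proof -
  interpret A: jump_weights "- r" a by fact
  have cx: "cadlag_from (- r) x" and cy: "cadlag_from (- r) (y n)" for n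
    using x y by (auto simp: solves_def)
  \<comment> \<open>\<open>G n t\<close> looks strictly before \<open>t\<close>, so a later time is
    needed to cover \<open>T\<close> itself.\<close>
  define T' where "T' = T + 1"
  obtain Bx where Bx: "\<And>u. - r \<le> u \<Longrightarrow> u \<le> T' \<Longrightarrow> \<bar>x u\<bar> \<le> Bx" and Bx0: "0 \<le> Bx"
    using cadlag_from_bounded[OF cx] by metis
  \<comment> \<open>The inserted 0 gives the supremum a meaning when the interval is empty, as
    happens for \<open>t = 0\<close> if \<open>r = 0\<close>.\<close>
  define G where "G n t = Sup (insert 0 ((\<lambda>s. \<bar>y n s - x s\<bar>) ` {- r..<t}))" for n t
  have bdd: "bdd_above (insert 0 ((\<lambda>s. \<bar>y n s - x s\<bar>) ` {- r..<t}))" for n t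
  proof -
    obtain C where "\<And>s. - r \<le> s \<Longrightarrow> s \<le> t \<Longrightarrow> \<bar>y n s - x s\<bar> \<le> C"
      using cadlag_from_bounded[OF cadlag_from_diff[OF cy cx]] by metis
    then show ?thesis by (auto intro!: bdd_aboveI2[of _ _ C])
  qed
  have G0: "0 \<le> G n t" for n t
    unfolding G_def by (intro cSup_upper bdd) simp
  have G_upper: "\<bar>y n u - x u\<bar> \<le> G n t" if "- r \<le> u" "u < t" for n u t
    unfolding G_def using that by (intro cSup_upper bdd) auto
  have G_least: "G n t \<le> C" if "0 \<le> C" "\<And>u. - r \<le> u \<Longrightarrow> u < t \<Longrightarrow> \<bar>y n u - x u\<bar> \<le> C" for n t C
    unfolding G_def using that by (intro cSup_least) auto
  define K where "K = c\<^sub>\<mu> + p * C\<^sub>\<mu> + C\<^sub>\<nu> * A.S T'"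
  define N where "N = K * T' + c\<^sub>\<nu> * A.S T'"
  define \<epsilon> where "\<epsilon> n = (T' * C\<^sub>\<nu> + c\<^sub>\<nu>) * Bx * (\<Sum>\<^sub>\<infinity>u\<in>{- r<..T'}. a u - b n u)" for n
  have K0: "0 \<le> K" and N0: "0 \<le> N"
    unfolding N_def K_def T'_def using c_nonneg C_nonneg pq A.S_nonneg T
    by (intro add_nonneg_nonneg mult_nonneg_nonneg; auto)+
  have \<epsilon>0: "0 \<le> \<epsilon> n" for n
    unfolding \<epsilon>_def T'_def using c_nonneg C_nonneg Bx0 T ba
    by (intro mult_nonneg_nonneg add_nonneg_nonneg infsum_nonneg) (auto simp: diff_ge_0_iff_ge)
  have \<epsilon>: "\<epsilon> \<longlonglongrightarrow> 0"
    unfolding \<epsilon>_def by (intro tendsto_mult_right_zero residual_weights_tendsto_0 A B ba ev)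
  have step: "(\<lambda>n. G n t) \<longlonglongrightarrow> 0"
    if st: "0 \<le> s" "s \<le> t" "t \<le> T'" and \<delta>: "\<And>t'. s \<le> t' \<Longrightarrow> t' < t \<Longrightarrow> A.S t' - A.S s \<le> \<delta>"
      and small: "K * (t - s) + c\<^sub>\<nu> * \<delta> \<le> 1/2" and Gs: "(\<lambda>n. G n s) \<longlonglongrightarrow> 0" for s t \<delta>
  proof (rule tendsto_sandwich[OF _ _ tendsto_const])
    \<comment> \<open>In the factor \<open>1 + N\<close>, the 1 serves times before \<open>s\<close>
      and \<open>N\<close> the later ones. The term \<open>1/2 * G n t\<close> is then absorbed into
      the left side, which is legitimate because \<open>G n t\<close> is a real number, hence
      finite.\<close>
    have key: "G n t \<le> \<epsilon> n + (1 + N) * G n s + 1/2 * G n t" for n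
    proof (rule G_least)
      show "0 \<le> \<epsilon> n + (1 + N) * G n s + 1/2 * G n t"
        using \<epsilon>0[of n] N0 G0[of n] by (intro add_nonneg_nonneg mult_nonneg_nonneg) auto
      fix u assume u: "- r \<le> u" "u < t"
      have nn: "0 \<le> N * G n s" "0 \<le> G n s" "0 \<le> G n t" using N0 G0 by simp_all
      show "\<bar>y n u - x u\<bar> \<le> \<epsilon> n + (1 + N) * G n s + 1/2 * G n t"
      proof (cases "u < s")
        case True
        then show ?thesis
          using G_upper[of u s n] u nn \<epsilon>0[of n] unfolding distrib_right by linarith
      next
        case False
        have "\<bar>y n u - x u\<bar> \<le> \<epsilon> n + N * G n s + (K * (t - s) + c\<^sub>\<nu> * \<delta>) * G n t"
          unfolding \<epsilon>_def N_def K_def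
          by (rule solution_diff_step[OF A B ba x y]) (use False u st Bx G0 G_upper \<delta> in auto)
        also have "(K * (t - s) + c\<^sub>\<nu> * \<delta>) * G n t \<le> 1/2 * G n t"
          by (intro mult_right_mono small G0)
        finally show ?thesis
          using nn unfolding distrib_right by linarith
      qed
    qed
    have "G n t \<le> 2 * \<epsilon> n + 2 * (1 + N) * G n s" for n
      using key[of n] unfolding mult.assoc by linarith
    then show "\<forall>\<^sub>F n in sequentially. G n t \<le> 2 * \<epsilon> n + 2 * (1 + N) * G n s"
      by simp
    show "(\<lambda>n. 2 * \<epsilon> n + 2 * (1 + N) * G n s) \<longlonglongrightarrow> 0"
      by (intro tendsto_add_zero tendsto_mult_right_zero \<epsilon> Gs)
  qed (simp add: G0)
  define P where "P s t \<longleftrightarrow> (0 \<le> s \<longrightarrow> t \<le> T' \<longrightarrow> (\<lambda>n. G n s) \<longlonglongrightarrow> 0 \<longrightarrow> (\<lambda>n. G n t) \<longlonglongrightarrow> 0)" for s t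
  have "0 \<le> T'" using T by (simp add: T'_def)
  then have "P 0 T'"
  proof (induction rule: Bolzano)
    case (trans u v w)
    then show ?case unfolding P_def by auto
  next
    case (local z)
    \<comment> \<open>Mass and length contribute at most 1/4 each, together the 1/2 required by the
      step. Adding 1 in the denominators covers vanishing \<open>c\<^sub>\<nu>\<close> or
      \<open>K\<close>.\<close>
    define \<delta> where "\<delta> = 1 / (4 * (c\<^sub>\<nu> + 1))"
    define d\<^sub>0 where "d\<^sub>0 = 1 / (4 * (K + 1))"
    have \<delta>: "0 < \<delta>" "c\<^sub>\<nu> * \<delta> \<le> 1/4" and d\<^sub>0: "0 < d\<^sub>0" "K * d\<^sub>0 \<le> 1/4"
      unfolding \<delta>_def d\<^sub>0_def using c_nonneg K0 by (auto simp: field_simps)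
    obtain d\<^sub>1 where d\<^sub>1: "0 < d\<^sub>1" "\<And>t. z < t \<Longrightarrow> t < z + d\<^sub>1 \<Longrightarrow> A.S t - A.S z < \<delta>"
      using A.S_right_small[OF \<delta>(1)] by blast
    obtain s\<^sub>0 where s\<^sub>0: "s\<^sub>0 < z" "\<And>s t. s\<^sub>0 \<le> s \<Longrightarrow> t < z \<Longrightarrow> A.S t - A.S s \<le> \<delta>"
      using A.S_left_small[OF \<delta>(1)] by metis
    show ?case
    proof (intro exI[of _ "min d\<^sub>0 (min d\<^sub>1 (z - s\<^sub>0))"] conjI allI impI)
      show "0 < min d\<^sub>0 (min d\<^sub>1 (z - s\<^sub>0))" using d\<^sub>0 d\<^sub>1 s\<^sub>0 by auto
      fix u v assume uv: "u \<le> z \<and> z \<le> v \<and> v - u < min d\<^sub>0 (min d\<^sub>1 (z - s\<^sub>0))"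
      have small: "K * h + c\<^sub>\<nu> * \<delta> \<le> 1/2" if "h \<le> d\<^sub>0" for h
        using mult_left_mono[OF that K0] d\<^sub>0 \<delta> by linarith
      show "P u v"
        unfolding P_def
      proof (intro impI)
        assume u0: "0 \<le> u" and vT: "v \<le> T'" and "(\<lambda>n. G n u) \<longlonglongrightarrow> 0"
        \<comment> \<open>The point \<open>z\<close> is crossed in two steps: from \<open>u\<close>
          to \<open>z\<close> its atom is not reached, and from \<open>z\<close> to \<open>v\<close>
          that atom multiplies \<open>G n z\<close>, which tends to 0 by the first step.\<close>
        then have "(\<lambda>n. G n z) \<longlonglongrightarrow> 0"
          using uv by (intro step[of u z \<delta>] s\<^sub>0 small) auto
        then show "(\<lambda>n. G n v) \<longlonglongrightarrow> 0"
        proof (rule step[of z v \<delta>, rotated 5])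
          show "A.S t' - A.S z \<le> \<delta>" if "z \<le> t'" "t' < v" for t'
            using d\<^sub>1(2)[of t'] that uv \<delta>(1) by (cases "t' = z") auto
        qed (use uv u0 vT small[of "v - z"] in auto)
      qed
    qed
  qed
  moreover have "G n 0 = 0" for n
    using G0[of n 0] G_least[of 0 0 n] init by fastforce
  ultimately have lim: "(\<lambda>n. G n T') \<longlonglongrightarrow> 0"
    unfolding P_def by simp
  have ne: "{- r..T} \<noteq> {}" using T memory_le(3) by auto
  have up: "\<bar>y n s - x s\<bar> \<le> G n T'" if "s \<in> {- r..T}" for n s
    using that by (intro G_upper) (auto simp: T'_def)
  show ?thesis
  proof (rule tendsto_sandwich[OF _ _ tendsto_const lim])
    show "\<forall>\<^sub>F n in sequentially. (SUP s\<in>{- r..T}. \<bar>y n s - x s\<bar>) \<le> G n T'"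
      using ne up by (intro always_eventually allI cSUP_least) auto
    have "0 \<le> (SUP s\<in>{- r..T}. \<bar>y n s - x s\<bar>)" for n
    proof -
      have "\<bar>y n T - x T\<bar> \<le> (SUP s\<in>{- r..T}. \<bar>y n s - x s\<bar>)"
        using T memory_le(3) up by (intro cSUP_upper bdd_aboveI2[of _ _ "G n T'"]) auto
      then show ?thesis using abs_ge_zero[of "y n T - x T"] by linarith
    qed
    then show "\<forall>\<^sub>F n in sequentially. 0 \<le> (SUP s\<in>{- r..T}. \<bar>y n s - x s\<bar>)"
      by simp
  qed
qed

end

section \<open>Summability of the squared jumps of the Levy process\<close>

text \<open>Each jump time lies in one partition interval, over which the increment tends to the
  jump as the mesh shrinks. Finitely many jump times eventually occupy different intervals, and the
  remaining squares are dropped. A lower limit suffices because Fatou's lemma takes over.\<close>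

lemma sum_sq_jumps_le_liminf:
  assumes g: "cadlag_from a g" and T: "a < T" and J: "finite J" "J \<subseteq> {a<..T}"
  defines "t \<equiv> \<lambda>k i. a + (T - a) * (real i / real (Suc k))"
  shows "ennreal (\<Sum>s\<in>J. (jump g s)\<^sup>2)
    \<le> liminf (\<lambda>k. ennreal (\<Sum>i<Suc k. (g (t k (Suc i)) - g (t k i))\<^sup>2))"
proof -
  \<comment> \<open>\<open>w\<close> rescales \<open>{a<..T}\<close> to \<open>{0<..1}\<close>, and
    \<open>i k s\<close> is the index of the interval, open on the left and closed on the right,
    that contains \<open>s\<close>; hence the ceiling minus one.\<close>
  define w where "w s = (s - a) / (T - a)" for s
  define i where "i k s = nat (\<lceil>w s * real (Suc k)\<rceil> - 1)" for k s
  have w: "0 < w s" "w s \<le> 1" "s = a + (T - a) * w s" if "s \<in> J" for s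
    using that J T by (auto simp: w_def)
  have ceil1: "1 \<le> \<lceil>w s * real (Suc k)\<rceil>" if "s \<in> J" for s k
  proof -
    have "0 < w s * real (Suc k)" using w[OF that] by (intro mult_pos_pos) auto
    then show ?thesis by (simp del: of_nat_Suc)
  qed
  have i_real: "real (i k s) = of_int \<lceil>w s * real (Suc k)\<rceil> - 1" if "s \<in> J" for s k
    using ceil1[OF that, of k] by (simp add: i_def del: of_nat_Suc)
  have i_lt: "i k s < Suc k" if "s \<in> J" for s k
  proof -
    have "w s * real (Suc k) \<le> real (Suc k)"
      using w[OF that] by (intro mult_left_le_one_le) auto
    then have "\<lceil>w s * real (Suc k)\<rceil> \<le> int (Suc k)" by (simp add: ceiling_le_iff del: of_nat_Suc)
    then show ?thesis unfolding i_def using ceil1[OF that, of k] by linarith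
  qed
  have left: "(\<lambda>k. g (t k (i k s))) \<longlonglongrightarrow> lft g s" if s: "s \<in> J" for s
  proof -
    have lim: "filterlim (\<lambda>k. real (i k s) / real (Suc k)) (at_left (w s)) sequentially"
      using tendsto_at_left_grid[of "w s"] by (simp add: i_real[OF s] del: of_nat_Suc)
    have eq: "a + (T - a) * w s = s" using w(3)[OF s] by simp
    have wl: "(\<lambda>k. real (i k s) / real (Suc k)) \<longlonglongrightarrow> w s"
      and wlt: "\<forall>\<^sub>F k in sequentially. real (i k s) / real (Suc k) < w s"
      using lim by (auto simp: filterlim_at elim: eventually_mono)
    have "filterlim (\<lambda>k. t k (i k s)) (at_left s) sequentially"
    proof (rule tendsto_imp_filterlim_at_left)
      show "(\<lambda>k. t k (i k s)) \<longlonglongrightarrow> s"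
        using tendsto_add[OF tendsto_const[of a] tendsto_mult[OF tendsto_const[of "T - a"] wl]]
        unfolding t_def eq .
      show "\<forall>\<^sub>F k in sequentially. t k (i k s) < s"
        using wlt
      proof eventually_elim
        case (elim k)
        then have "(T - a) * (real (i k s) / real (Suc k)) < (T - a) * w s"
          using T by (intro mult_strict_left_mono) auto
        then show ?case unfolding t_def using eq by linarith
      qed
    qed
    moreover have "a < s" using s J by auto
    ultimately show ?thesis
      using filterlim_compose[OF cadlag_from_tendsto_lft[OF g]] by blast
  qed
  \<comment> \<open>The right end point may equal \<open>s\<close>, so the limit along
    \<open>at_right s\<close> does not apply directly and that case is handled apart.\<close>
  have right: "(\<lambda>k. g (t k (Suc (i k s)))) \<longlonglongrightarrow> g s" if s: "s \<in> J" for s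
  proof (rule tendstoI)
    fix e :: real assume "0 < e"
    have "a \<le> s" using s J by auto
    from tendstoD[OF cadlag_from_tendsto_right[OF g this] \<open>0 < e\<close>]
    obtain d where d: "s < d" "\<And>u. s < u \<Longrightarrow> u < d \<Longrightarrow> dist (g u) (g s) < e"
      unfolding eventually_at_right_field by auto
    have ge: "s \<le> t k (Suc (i k s))" for k
    proof -
      have "w s * real (Suc k) \<le> real (Suc (i k s))"
        using i_real[OF s, of k] le_of_int_ceiling[of "w s * real (Suc k)"] by simp
      then have "w s \<le> real (Suc (i k s)) / real (Suc k)"
        by (subst pos_le_divide_eq) auto
      then have "(T - a) * w s \<le> (T - a) * (real (Suc (i k s)) / real (Suc k))"
        using T by (intro mult_left_mono) auto
      then show ?thesis
        unfolding t_def using w(3)[OF s] by linarith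
    qed
    have le: "t k (Suc (i k s)) \<le> s + (T - a) * (1 / real (Suc k))" for k
    proof -
      have "real (Suc (i k s)) \<le> w s * real (Suc k) + 1"
        using i_real[OF s, of k] ceiling_correct[of "w s * real (Suc k)"] by simp
      then have "real (Suc (i k s)) / real (Suc k) \<le> (w s * real (Suc k) + 1) / real (Suc k)"
        by (intro divide_right_mono) auto
      also have "\<dots> = w s + 1 / real (Suc k)"
        by (simp add: add_divide_distrib del: of_nat_Suc)
      finally have "(T - a) * (real (Suc (i k s)) / real (Suc k)) \<le> (T - a) * (w s + 1 / real (Suc k))"
        using T by (intro mult_left_mono) auto
      then show ?thesis
        using w(3)[OF s] unfolding t_def distrib_left by linarith
    qed
    have "(\<lambda>k. s + (T - a) * (1 / real (Suc k))) \<longlonglongrightarrow> s + (T - a) * 0"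
      by (intro tendsto_intros LIMSEQ_Suc[OF lim_1_over_n])
    then have "\<forall>\<^sub>F k in sequentially. s + (T - a) * (1 / real (Suc k)) < d"
      using d(1) by (intro order_tendstoD(2)) auto
    then show "\<forall>\<^sub>F k in sequentially. dist (g (t k (Suc (i k s)))) (g s) < e"
    proof eventually_elim
      case (elim k)
      then show ?case
        using ge[of k] le[of k] d(2)[of "t k (Suc (i k s))"] \<open>0 < e\<close>
        by (cases "t k (Suc (i k s)) = s") auto
    qed
  qed
  have "\<forall>\<^sub>F k in sequentially. \<forall>s\<in>J. \<forall>s'\<in>J. s \<noteq> s' \<longrightarrow> i k s \<noteq> i k s'"
  proof (intro eventually_ball_finite ballI J)
    fix s s' assume s: "s \<in> J" "s' \<in> J"
    show "\<forall>\<^sub>F k in sequentially. s \<noteq> s' \<longrightarrow> i k s \<noteq> i k s'"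
    proof (cases "s = s'")
      case False
      then have ww: "w s \<noteq> w s'" using w(3)[OF s(1)] w(3)[OF s(2)] by auto
      \<comment> \<open>For \<open>k \<ge> m\<close> the rescaled positions are more than 1 apart,
        so their ceilings differ.\<close>
      obtain m :: nat where m: "1 / \<bar>w s - w s'\<bar> < real m" using reals_Archimedean2 by blast
      have "i k s \<noteq> i k s'" if "m \<le> k" for k
      proof
        assume eq: "i k s = i k s'"
        have "1 / \<bar>w s - w s'\<bar> < real (Suc k)" using m that by simp
        then have "1 < \<bar>w s - w s'\<bar> * real (Suc k)"
          using ww by (simp add: divide_less_eq mult.commute del: of_nat_Suc)
        then have "1 < \<bar>w s * real (Suc k) - w s' * real (Suc k)\<bar>"
          by (simp add: abs_mult left_diff_distrib[symmetric] del: of_nat_Suc)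
        moreover have "\<lceil>w s * real (Suc k)\<rceil> = \<lceil>w s' * real (Suc k)\<rceil>"
          using i_real[OF s(1), of k] i_real[OF s(2), of k] eq by simp
        ultimately show False
          using ceiling_correct[of "w s * real (Suc k)"] ceiling_correct[of "w s' * real (Suc k)"]
          by linarith
      qed
      then show ?thesis unfolding eventually_sequentially by blast
    qed simp
  qed
  then have "\<forall>\<^sub>F k in sequentially. ennreal (\<Sum>s\<in>J. (g (t k (Suc (i k s))) - g (t k (i k s)))\<^sup>2)
      \<le> ennreal (\<Sum>i<Suc k. (g (t k (Suc i)) - g (t k i))\<^sup>2)"
  proof eventually_elim
    case (elim k)
    then have inj: "inj_on (i k) J" by (auto simp: inj_on_def)
    have "(\<Sum>s\<in>J. (g (t k (Suc (i k s))) - g (t k (i k s)))\<^sup>2)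
        = (\<Sum>i\<in>i k ` J. (g (t k (Suc i)) - g (t k i))\<^sup>2)"
      by (simp add: sum.reindex[OF inj])
    also have "\<dots> \<le> (\<Sum>i<Suc k. (g (t k (Suc i)) - g (t k i))\<^sup>2)"
      using i_lt by (intro sum_mono2) auto
    finally show ?case by (rule ennreal_leI)
  qed
  then have "liminf (\<lambda>k. ennreal (\<Sum>s\<in>J. (g (t k (Suc (i k s))) - g (t k (i k s)))\<^sup>2))
      \<le> liminf (\<lambda>k. ennreal (\<Sum>i<Suc k. (g (t k (Suc i)) - g (t k i))\<^sup>2))"
    by (rule Liminf_mono)
  moreover have "(\<lambda>k. ennreal (\<Sum>s\<in>J. (g (t k (Suc (i k s))) - g (t k (i k s)))\<^sup>2))
      \<longlonglongrightarrow> ennreal (\<Sum>s\<in>J. (jump g s)\<^sup>2)"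
    unfolding jump_def by (intro tendsto_ennrealI tendsto_sum tendsto_power tendsto_diff left right)
  ultimately show ?thesis
    by (simp add: lim_imp_Liminf)
qed

section \<open>Second moments of the Levy process\<close>

lemma Int_stable_vimage: "Int_stable {f -` A \<inter> \<Omega> |A. A \<in> sets N}"
proof (rule Int_stableI)
  fix E D assume "E \<in> {f -` A \<inter> \<Omega> |A. A \<in> sets N}" "D \<in> {f -` A \<inter> \<Omega> |A. A \<in> sets N}"
  then obtain A B where "E = f -` A \<inter> \<Omega>" "A \<in> sets N" "D = f -` B \<inter> \<Omega>" "B \<in> sets N"
    by auto
  then have "E \<inter> D = f -` (A \<inter> B) \<inter> \<Omega>" "A \<inter> B \<in> sets N" by auto
  then show "E \<inter> D \<in> {f -` A \<inter> \<Omega> |A. A \<in> sets N}" by blast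
qed

text \<open>By Fubini for the product law, the second moment of \<open>x + Y\<close> is finite for
  almost every \<open>x\<close> under the law of \<open>X\<close>, hence for some \<open>x\<close>;
  a fixed shift preserves square integrability. No moment of \<open>X\<close> is
  presupposed.\<close>

lemma (in prob_space) indep_var_square_integrable:
  assumes ind: "indep_var borel X borel Y" and int: "integrable M (\<lambda>\<omega>. (X \<omega> + Y \<omega>)\<^sup>2 :: real)"
  shows "integrable M (\<lambda>\<omega>. (Y \<omega>)\<^sup>2)"
proof -
  have [measurable]: "random_variable borel X" "random_variable borel Y"
    and dist: "distr M borel X \<Otimes>\<^sub>M distr M borel Y = distr M (borel \<Otimes>\<^sub>M borel) (\<lambda>\<omega>. (X \<omega>, Y \<omega>))"
    using ind by (auto simp: indep_var_distribution_eq)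
  interpret DX: prob_space "distr M borel X" by (rule prob_space_distr) simp
  interpret DY: prob_space "distr M borel Y" by (rule prob_space_distr) simp
  let ?f = "\<lambda>x. \<integral>\<^sup>+\<omega>. ennreal ((x + Y \<omega>)\<^sup>2) \<partial>M"
  have "(\<integral>\<^sup>+x. ?f x \<partial>distr M borel X)
      = (\<integral>\<^sup>+x. \<integral>\<^sup>+y. ennreal ((x + y)\<^sup>2) \<partial>distr M borel Y \<partial>distr M borel X)"
    by (simp add: nn_integral_distr)
  also have "\<dots> = (\<integral>\<^sup>+z. ennreal ((fst z + snd z)\<^sup>2) \<partial>(distr M borel X \<Otimes>\<^sub>M distr M borel Y))"
    by (subst DY.nn_integral_fst[symmetric]) auto
  also have "\<dots> = (\<integral>\<^sup>+\<omega>. ennreal ((X \<omega> + Y \<omega>)\<^sup>2) \<partial>M)"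
    unfolding dist by (subst nn_integral_distr) auto
  also have "\<dots> < \<infinity>"
    using int by (subst nn_integral_eq_integral) auto
  finally have fin: "(\<integral>\<^sup>+x. ?f x \<partial>distr M borel X) \<noteq> \<infinity>" by simp
  have ae: "AE x in distr M borel X. ?f x \<noteq> \<infinity>"
    by (rule nn_integral_PInf_AE[OF _ fin]) simp
  have "\<exists>x. ?f x \<noteq> \<infinity>"
  proof (rule ccontr)
    assume "\<nexists>x. ?f x \<noteq> \<infinity>"
    with ae have "AE x in distr M borel X. False" by simp
    then show False using DX.AE_False by blast
  qed
  then obtain x where "?f x < \<infinity>" by (auto simp: top.not_eq_extremum)
  then have ix: "integrable M (\<lambda>\<omega>. (x + Y \<omega>)\<^sup>2)"
    by (intro integrableI_bounded) auto
  show ?thesis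
  proof (rule Bochner_Integration.integrable_bound)
    show "integrable M (\<lambda>\<omega>. 2 * (x + Y \<omega>)\<^sup>2 + 2 * x\<^sup>2)" using ix by auto
    have "y\<^sup>2 \<le> 2 * (x + y)\<^sup>2 + 2 * x\<^sup>2" for y :: real
      using zero_le_power2[of "y + 2 * x"] by (simp add: power2_eq_square algebra_simps)
    then show "AE \<omega> in M. norm ((Y \<omega>)\<^sup>2) \<le> norm (2 * (x + Y \<omega>)\<^sup>2 + 2 * x\<^sup>2)"
      by (intro AE_I2) (auto intro!: order_trans[OF _ abs_ge_self])
  qed simp
qed

lemma integrable_square_add:
  fixes X Y :: "'a \<Rightarrow> real"
  assumes [measurable]: "X \<in> borel_measurable M" "Y \<in> borel_measurable M"
    and "integrable M (\<lambda>\<omega>. (X \<omega>)\<^sup>2)" "integrable M (\<lambda>\<omega>. (Y \<omega>)\<^sup>2)"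
  shows "integrable M (\<lambda>\<omega>. (X \<omega> + Y \<omega>)\<^sup>2)" "integrable M (\<lambda>\<omega>. (X \<omega> - Y \<omega>)\<^sup>2)"
proof -
  have i: "integrable M (\<lambda>\<omega>. 2 * (X \<omega>)\<^sup>2 + 2 * (Y \<omega>)\<^sup>2)" using assms by auto
  have "(x + y)\<^sup>2 \<le> 2 * x\<^sup>2 + 2 * y\<^sup>2" "(x - y)\<^sup>2 \<le> 2 * x\<^sup>2 + 2 * y\<^sup>2" for x y :: real
    using zero_le_power2[of "x - y"] zero_le_power2[of "x + y"]
    by (simp_all add: power2_eq_square algebra_simps)
  then show "integrable M (\<lambda>\<omega>. (X \<omega> + Y \<omega>)\<^sup>2)" "integrable M (\<lambda>\<omega>. (X \<omega> - Y \<omega>)\<^sup>2)"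
    by (auto intro!: Bochner_Integration.integrable_bound[OF i] AE_I2 order_trans[OF _ abs_ge_self])
qed

locale levy_setting = prob_space M
  for M :: "'a measure" and r :: real and F :: "real \<Rightarrow> 'a measure" and L :: "real \<Rightarrow> 'a \<Rightarrow> real" +
  assumes r_nonneg: "0 \<le> r" and filt: "usual_filtration M r F" and levy: "levy_pure_jump_centered M r F L"
begin

lemma filtration_subset:
  "- r \<le> t \<Longrightarrow> space (F t) = space M" "- r \<le> t \<Longrightarrow> sets (F t) \<subseteq> sets M"
  using filt[unfolded usual_filtration_def, THEN conjunct1] by simp_all

lemma adapted_measurable:
  assumes "adapted r F X" "- r \<le> t"
  shows "X t \<in> borel_measurable M"
proof -
  have "space (F t) = space M" "sets (F t) \<subseteq> sets M"
    using assms(2) by (auto dest: filtration_subset)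
  then have "borel_measurable (F t) \<subseteq> borel_measurable M"
    by (auto simp: measurable_def)
  then show ?thesis using assms by (auto simp: adapted_def)
qed

lemma L_measurable: "- r \<le> t \<Longrightarrow> L t \<in> borel_measurable M"
  using levy by (intro adapted_measurable) (auto simp: levy_pure_jump_centered_def)

lemma L_centered: "- r \<le> t \<Longrightarrow> integrable M (L t)" "- r \<le> t \<Longrightarrow> expectation (L t) = 0"
  using levy by (auto simp: levy_pure_jump_centered_def)

lemma L_start: "\<omega> \<in> space M \<Longrightarrow> L (- r) \<omega> = 0"
  using levy by (auto simp: levy_pure_jump_centered_def)

lemma L_cadlag: "\<omega> \<in> space M \<Longrightarrow> cadlag_from (- r) (\<lambda>t. L t \<omega>)"
  using levy by (auto simp: levy_pure_jump_centered_def)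

lemma increment_indep:
  assumes st: "- r \<le> s" "s \<le> t"
  shows "indep_var borel (L s) borel (\<lambda>\<omega>. L t \<omega> - L s \<omega>)"
proof -
  have [measurable]: "L s \<in> borel_measurable M" "L t \<in> borel_measurable M"
    using st by (auto intro: L_measurable)
  have Ls: "L s \<in> borel_measurable (F s)"
    using levy st by (auto simp: levy_pure_jump_centered_def adapted_def)
  have sp: "space (F s) = space M" using st(1) by (rule filtration_subset(1))
  have "indep_set {L s -` A \<inter> space M |A. A \<in> sets borel}
     {(\<lambda>\<omega>. L t \<omega> - L s \<omega>) -` A \<inter> space M |A. A \<in> sets borel}"
  proof (rule indep_setI)
    show "{L s -` A \<inter> space M |A. A \<in> sets borel} \<subseteq> events"
      "{(\<lambda>\<omega>. L t \<omega> - L s \<omega>) -` A \<inter> space M |A. A \<in> sets borel} \<subseteq> events"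
      by (auto intro!: measurable_sets)
    fix E D assume "E \<in> {L s -` A \<inter> space M |A. A \<in> sets borel}"
      "D \<in> {(\<lambda>\<omega>. L t \<omega> - L s \<omega>) -` A \<inter> space M |A. A \<in> sets borel}"
    then obtain A B where AB: "E = L s -` A \<inter> space M" "A \<in> sets borel"
      "D = (\<lambda>\<omega>. L t \<omega> - L s \<omega>) -` B \<inter> space M" "B \<in> sets borel"
      by auto
    have "E \<in> sets (F s)" using measurable_sets[OF Ls AB(2)] AB(1) sp by simp
    moreover have "D = {\<omega> \<in> space M. L t \<omega> - L s \<omega> \<in> B}" using AB by auto
    ultimately show "prob (E \<inter> D) = prob E * prob D"
      using levy st AB(4) unfolding levy_pure_jump_centered_def by auto
  qed
  then show ?thesis
    unfolding indep_var_eq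
    by (intro conjI indep_set_sigma_sets Int_stable_vimage) auto
qed

text \<open>The moment assumption concerns time 1 only. Earlier times are reached by splitting off
  the independent increment \<open>L 1 - L t\<close>, later ones by adding stationary increments of
  length \<open>1 + r\<close>.\<close>

lemma L_square_integrable:
  assumes "- r \<le> t"
  shows "integrable M (\<lambda>\<omega>. (L t \<omega>)\<^sup>2)"
proof -
  have m1 [measurable]: "L 1 \<in> borel_measurable M" using r_nonneg by (auto intro: L_measurable)
  have L1: "integrable M (\<lambda>\<omega>. (L 1 \<omega>)\<^sup>2)"
  proof (rule Bochner_Integration.integrable_bound)
    show "integrable M (\<lambda>\<omega>. 1 + (L 1 \<omega>) ^ 4)"
      using levy by (auto simp: levy_pure_jump_centered_def)
    have "x\<^sup>2 \<le> 1 + x ^ 4" for x :: real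
    proof -
      have "2 * x\<^sup>2 \<le> 1 + x ^ 4"
        using zero_le_power2[of "x\<^sup>2 - 1"] unfolding power2_diff power_mult[symmetric] by simp
      then show ?thesis using zero_le_power2[of x] by linarith
    qed
    then show "AE \<omega> in M. norm ((L 1 \<omega>)\<^sup>2) \<le> norm (1 + (L 1 \<omega>) ^ 4)"
      by (intro AE_I2) (auto intro!: order_trans[OF _ abs_ge_self])
  qed simp
  have base: "integrable M (\<lambda>\<omega>. (L t \<omega>)\<^sup>2)" if t: "- r \<le> t" "t \<le> 1" for t
  proof -
    have mt [measurable]: "L t \<in> borel_measurable M" using t by (auto intro: L_measurable)
    have "integrable M (\<lambda>\<omega>. (L 1 \<omega> - L t \<omega>)\<^sup>2)"
      using L1 by (intro indep_var_square_integrable[OF increment_indep[OF t]]) simp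
    from integrable_square_add(2)[OF m1 _ L1 this] show ?thesis by simp
  qed
  have "integrable M (\<lambda>\<omega>. (L t \<omega>)\<^sup>2)" if "- r \<le> t" "t \<le> - r + real k * (1 + r)" for t and k :: nat
    using that
  proof (induction k arbitrary: t)
    case 0
    then show ?case using r_nonneg by (intro base) auto
  next
    case (Suc k)
    show ?case
    proof (cases "t \<le> 1")
      case True
      then show ?thesis using Suc.prems by (intro base) auto
    next
      case False
      define h where "h = t - 1"
      have h: "0 \<le> h" "- r + h \<le> - r + real k * (1 + r)" "t = 1 + h"
        using False Suc.prems by (auto simp: h_def algebra_simps)
      have mh [measurable]: "L (- r + h) \<in> borel_measurable M" "L t \<in> borel_measurable M"
        using h r_nonneg by (auto intro!: L_measurable)
      have ms: "L (- r) \<in> borel_measurable M" by (auto intro!: L_measurable)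
      \<comment> \<open>Both time spans have length \<open>1 + r\<close>; as \<open>L\<close> starts
        from 0 at time \<open>- r\<close>, the right side is the law of \<open>L 1\<close>.\<close>
      have "distr M borel (\<lambda>\<omega>. L t \<omega> - L (- r + h) \<omega>) = distr M borel (\<lambda>\<omega>. L 1 \<omega> - L (- r) \<omega>)"
        using levy h r_nonneg unfolding levy_pure_jump_centered_def by auto
      moreover have "integrable (distr M borel (\<lambda>\<omega>. L 1 \<omega> - L (- r) \<omega>)) (\<lambda>x. x\<^sup>2)"
        using L1 ms by (subst integrable_distr_eq) (auto simp: L_start cong: Bochner_Integration.integrable_cong)
      ultimately have "integrable (distr M borel (\<lambda>\<omega>. L t \<omega> - L (- r + h) \<omega>)) (\<lambda>x. x\<^sup>2)"
        by simp
      then have "integrable M (\<lambda>\<omega>. (L t \<omega> - L (- r + h) \<omega>)\<^sup>2)"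
        by (rule integrable_distr[rotated]) measurable
      from integrable_square_add(1)[OF borel_measurable_diff[OF mh(2,1)] mh(1) this Suc.IH[of "- r + h"]] h show ?thesis by simp
    qed
  qed
  moreover obtain k :: nat where "(t + r) / (1 + r) \<le> real k" using real_arch_simple by blast
  then have "t \<le> - r + real k * (1 + r)" using r_nonneg by (simp add: divide_le_eq)
  ultimately show ?thesis using assms by blast
qed

text \<open>\<open>L s\<close> and the later increment are independent and the increment is
  centered, so the cross term has mean zero. The difference form is chosen for telescoping along
  partitions.\<close>

lemma increment_variance:
  assumes st: "- r \<le> s" "s \<le> t"
  shows "integrable M (\<lambda>\<omega>. (L t \<omega> - L s \<omega>)\<^sup>2)"
    and "expectation (\<lambda>\<omega>. (L t \<omega> - L s \<omega>)\<^sup>2) = expectation (\<lambda>\<omega>. (L t \<omega>)\<^sup>2) - expectation (\<lambda>\<omega>. (L s \<omega>)\<^sup>2)"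
proof -
  have t: "- r \<le> t" using st by simp
  have i: "integrable M (\<lambda>\<omega>. L t \<omega> - L s \<omega>)" "expectation (\<lambda>\<omega>. L t \<omega> - L s \<omega>) = 0"
    using L_centered t st by auto
  note sq = L_square_integrable[OF st(1)] L_square_integrable[OF t]
  show d: "integrable M (\<lambda>\<omega>. (L t \<omega> - L s \<omega>)\<^sup>2)"
    by (intro integrable_square_add(2) L_measurable t st sq)
  have c: "integrable M (\<lambda>\<omega>. L s \<omega> * (L t \<omega> - L s \<omega>))"
    "expectation (\<lambda>\<omega>. L s \<omega> * (L t \<omega> - L s \<omega>)) = 0"
    using indep_var_integrable[OF increment_indep[OF st] L_centered(1)[OF st(1)] i(1)]
      indep_var_lebesgue_integral[OF increment_indep[OF st] L_centered(1)[OF st(1)] i(1)] i(2) by auto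
  have "(L t \<omega>)\<^sup>2 = (L s \<omega>)\<^sup>2 + 2 * (L s \<omega> * (L t \<omega> - L s \<omega>)) + (L t \<omega> - L s \<omega>)\<^sup>2" for \<omega>
    by (simp add: power2_eq_square algebra_simps)
  then have "expectation (\<lambda>\<omega>. (L t \<omega>)\<^sup>2)
      = expectation (\<lambda>\<omega>. (L s \<omega>)\<^sup>2 + 2 * (L s \<omega> * (L t \<omega> - L s \<omega>)) + (L t \<omega> - L s \<omega>)\<^sup>2)"
    by presburger
  also have "\<dots> = expectation (\<lambda>\<omega>. (L s \<omega>)\<^sup>2) + expectation (\<lambda>\<omega>. (L t \<omega> - L s \<omega>)\<^sup>2)"
    using sq c d by simp
  finally show "expectation (\<lambda>\<omega>. (L t \<omega> - L s \<omega>)\<^sup>2) = expectation (\<lambda>\<omega>. (L t \<omega>)\<^sup>2) - expectation (\<lambda>\<omega>. (L s \<omega>)\<^sup>2)"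
    by simp
qed

text \<open>The expected sum of squared increments telescopes to the same finite number for every
  partition, which makes the bound in Fatou's lemma uniform. The resulting pathwise bound
  \<open>C\<close> does not depend on the finite set of jumps, as summability of nonnegative terms
  requires.\<close>

lemma AE_sq_jumps_summable_upto:
  assumes T: "- r < T"
  shows "AE \<omega> in M. (\<lambda>s. (jump (\<lambda>u. L u \<omega>) s)\<^sup>2) summable_on {- r<..T}"
proof -
  define t where "t k i = - r + (T - - r) * (real i / real (Suc k))" for k i :: nat
  define q where "q k \<omega> = (\<Sum>i<Suc k. (L (t k (Suc i)) \<omega> - L (t k i) \<omega>)\<^sup>2)" for k \<omega>
  have t_ge: "- r \<le> t k i" and t_mono: "t k i \<le> t k (Suc i)" for k i
    using T by (auto simp: t_def intro!: mult_nonneg_nonneg mult_left_mono divide_right_mono)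
  have [measurable]: "L (t k i) \<in> borel_measurable M" for k i
    by (intro L_measurable t_ge)
  have q_nonneg: "0 \<le> q k \<omega>" for k \<omega>
    unfolding q_def by (intro sum_nonneg) simp
  have q_int: "integrable M (q k)" for k
    unfolding q_def by (intro Bochner_Integration.integrable_sum increment_variance t_ge t_mono)
  have q_exp: "expectation (q k) = expectation (\<lambda>\<omega>. (L T \<omega>)\<^sup>2) - expectation (\<lambda>\<omega>. (L (- r) \<omega>)\<^sup>2)" for k
  proof -
    have "expectation (q k) = (\<Sum>i<Suc k. expectation (\<lambda>\<omega>. (L (t k (Suc i)) \<omega>)\<^sup>2) - expectation (\<lambda>\<omega>. (L (t k i) \<omega>)\<^sup>2))"
      unfolding q_def
      by (subst Bochner_Integration.integral_sum)
         (auto simp only: increment_variance[OF t_ge t_mono])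
    also have "\<dots> = expectation (\<lambda>\<omega>. (L (t k (Suc k)) \<omega>)\<^sup>2) - expectation (\<lambda>\<omega>. (L (t k 0) \<omega>)\<^sup>2)"
      by (rule sum_lessThan_telescope)
    finally show ?thesis by (simp add: t_def)
  qed
  have "(\<integral>\<^sup>+\<omega>. liminf (\<lambda>k. ennreal (q k \<omega>)) \<partial>M) \<le> liminf (\<lambda>k. \<integral>\<^sup>+\<omega>. ennreal (q k \<omega>) \<partial>M)"
    by (intro nn_integral_liminf) (simp add: q_def)
  also have "(\<lambda>k. \<integral>\<^sup>+\<omega>. ennreal (q k \<omega>) \<partial>M)
      = (\<lambda>k. ennreal (expectation (\<lambda>\<omega>. (L T \<omega>)\<^sup>2) - expectation (\<lambda>\<omega>. (L (- r) \<omega>)\<^sup>2)))"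
    using q_int by (subst nn_integral_eq_integral) (auto simp only: q_exp q_nonneg intro!: AE_I2)
  finally have "(\<integral>\<^sup>+\<omega>. liminf (\<lambda>k. ennreal (q k \<omega>)) \<partial>M) \<noteq> \<infinity>"
    by (auto simp: Liminf_const top_unique)
  then have "AE \<omega> in M. liminf (\<lambda>k. ennreal (q k \<omega>)) \<noteq> \<infinity>"
    by (intro nn_integral_PInf_AE) (simp_all add: q_def)
  then show ?thesis
  proof (rule AE_mp, intro AE_I2 impI)
    fix \<omega> assume \<omega>: "\<omega> \<in> space M" and fin: "liminf (\<lambda>k. ennreal (q k \<omega>)) \<noteq> \<infinity>"
    then obtain C where C: "0 \<le> C" "liminf (\<lambda>k. ennreal (q k \<omega>)) = ennreal C"
      by (cases "liminf (\<lambda>k. ennreal (q k \<omega>))") auto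
    show "(\<lambda>s. (jump (\<lambda>u. L u \<omega>) s)\<^sup>2) summable_on {- r<..T}"
    proof (rule nonneg_bdd_above_summable_on)
      show "bdd_above (sum (\<lambda>s. (jump (\<lambda>u. L u \<omega>) s)\<^sup>2) ` {J. J \<subseteq> {- r<..T} \<and> finite J})"
      proof (rule bdd_aboveI2)
        fix J assume "J \<in> {J. J \<subseteq> {- r<..T} \<and> finite J}"
        then have "ennreal (\<Sum>s\<in>J. (jump (\<lambda>u. L u \<omega>) s)\<^sup>2) \<le> ennreal C"
          using sum_sq_jumps_le_liminf[OF L_cadlag[OF \<omega>] T, of J] C(2)
          unfolding q_def t_def by auto
        then show "(\<Sum>s\<in>J. (jump (\<lambda>u. L u \<omega>) s)\<^sup>2) \<le> C"
          using C(1) by simp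
      qed
    qed simp
  qed
qed

lemma AE_sq_jumps_summable:
  "AE \<omega> in M. \<forall>T. (\<lambda>s. (jump (\<lambda>u. L u \<omega>) s)\<^sup>2) summable_on {- r<..T}"
proof -
  have "AE \<omega> in M. \<forall>k::nat. (\<lambda>s. (jump (\<lambda>u. L u \<omega>) s)\<^sup>2) summable_on {- r<..real (Suc k)}"
    unfolding AE_all_countable using r_nonneg by (intro allI AE_sq_jumps_summable_upto) linarith
  then show ?thesis
  proof (rule AE_mp, intro AE_I2 impI allI)
    fix \<omega> T assume *: "\<forall>k::nat. (\<lambda>s. (jump (\<lambda>u. L u \<omega>) s)\<^sup>2) summable_on {- r<..real (Suc k)}"
    obtain k :: nat where "T \<le> real k" using real_arch_simple by blast
    then show "(\<lambda>s. (jump (\<lambda>u. L u \<omega>) s)\<^sup>2) summable_on {- r<..T}"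
      by (intro summable_on_subset[OF *[rule_format, of k]]) auto
  qed
qed

end

section \<open>Convergence in probability\<close>

text \<open>By right continuity, an excess over \<open>\<epsilon>\<close> at a time before
  \<open>t\<close> persists at some rational time shortly after, so countably many times decide the
  event. The end point \<open>t\<close> has no room to its right inside the interval and is added to
  the countable set.\<close>

lemma sets_SUP_cadlag_gt:
  assumes c: "\<And>\<omega>. \<omega> \<in> space M \<Longrightarrow> cadlag_from a (\<lambda>s. Z s \<omega>)"
    and m: "\<And>s. a \<le> s \<Longrightarrow> Z s \<in> borel_measurable M" and t: "a \<le> t"
  shows "{\<omega>\<in>space M. (SUP s\<in>{a..t}. \<bar>Z s \<omega>\<bar>) > \<epsilon>} \<in> sets M"
proof -
  define D where "D = insert t ({a..t} \<inter> \<rat>)"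
  have "(SUP s\<in>{a..t}. \<bar>Z s \<omega>\<bar>) > \<epsilon> \<longleftrightarrow> (\<exists>s\<in>D. \<bar>Z s \<omega>\<bar> > \<epsilon>)" if \<omega>: "\<omega> \<in> space M" for \<omega>
  proof -
    obtain C where "\<And>s. a \<le> s \<Longrightarrow> s \<le> t \<Longrightarrow> \<bar>Z s \<omega>\<bar> \<le> C"
      using cadlag_from_bounded[OF c[OF \<omega>]] by metis
    then have "bdd_above ((\<lambda>s. \<bar>Z s \<omega>\<bar>) ` {a..t})"
      by (auto intro!: bdd_aboveI2[of _ _ C])
    then have "(SUP s\<in>{a..t}. \<bar>Z s \<omega>\<bar>) > \<epsilon> \<longleftrightarrow> (\<exists>s\<in>{a..t}. \<bar>Z s \<omega>\<bar> > \<epsilon>)"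
      using t by (intro less_cSUP_iff) auto
    also have "\<dots> \<longleftrightarrow> (\<exists>s\<in>D. \<bar>Z s \<omega>\<bar> > \<epsilon>)"
    proof
      assume "\<exists>s\<in>{a..t}. \<bar>Z s \<omega>\<bar> > \<epsilon>"
      then obtain s where s: "a \<le> s" "s \<le> t" "\<bar>Z s \<omega>\<bar> > \<epsilon>" by auto
      show "\<exists>s\<in>D. \<bar>Z s \<omega>\<bar> > \<epsilon>"
      proof (cases "s = t")
        case False
        have "\<forall>\<^sub>F u in at_right s. \<epsilon> < \<bar>Z u \<omega>\<bar>"
          using cadlag_from_tendsto_right[OF c[OF \<omega>] s(1), THEN tendsto_rabs] s(3)
          by (rule order_tendstoD)
        then obtain d where d: "s < d" "\<And>u. s < u \<Longrightarrow> u < d \<Longrightarrow> \<epsilon> < \<bar>Z u \<omega>\<bar>"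
          unfolding eventually_at_right_field by auto
        obtain u where u: "u \<in> \<rat>" "s < u" "u < min d t"
          using Rats_dense_in_real[of s "min d t"] d(1) False s by auto
        then have "u \<in> D" using s unfolding D_def by auto
        with d(2)[of u] u show ?thesis by auto
      qed (use s in \<open>auto simp: D_def\<close>)
    qed (use t in \<open>auto simp: D_def\<close>)
    finally show ?thesis .
  qed
  then have "{\<omega>\<in>space M. (SUP s\<in>{a..t}. \<bar>Z s \<omega>\<bar>) > \<epsilon>} = (\<Union>s\<in>D. {\<omega>\<in>space M. \<bar>Z s \<omega>\<bar> > \<epsilon>})"
    by auto
  also have "\<dots> \<in> sets M"
  proof (rule sets.countable_UN'')
    show "countable D" unfolding D_def by (auto intro: countable_subset[OF _ countable_rat])
    fix s assume "s \<in> D"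
    then have [measurable]: "Z s \<in> borel_measurable M" using t by (auto simp: D_def intro: m)
    show "{\<omega>\<in>space M. \<bar>Z s \<omega>\<bar> > \<epsilon>} \<in> sets M" by measurable
  qed
  finally show ?thesis .
qed

text \<open>Dominated convergence for the indicators of the level sets; accordingly measurability is
  asked of these events, not of \<open>Z n\<close>, which will be a supremum over uncountably many
  times.\<close>

lemma (in prob_space) AE_tendsto_imp_prob_tendsto:
  fixes Z :: "nat \<Rightarrow> 'a \<Rightarrow> real"
  assumes m: "\<And>n. {\<omega>\<in>space M. Z n \<omega> > \<epsilon>} \<in> sets M" and lim: "AE \<omega> in M. (\<lambda>n. Z n \<omega>) \<longlonglongrightarrow> 0"
    and \<epsilon>: "0 < \<epsilon>"
  shows "(\<lambda>n. prob {\<omega>\<in>space M. Z n \<omega> > \<epsilon>}) \<longlonglongrightarrow> 0"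
proof -
  let ?A = "\<lambda>n. {\<omega>\<in>space M. Z n \<omega> > \<epsilon>}"
  have "(\<lambda>n. expectation (indicator (?A n))) \<longlonglongrightarrow> expectation (\<lambda>_. 0 :: real)"
  proof (rule integral_dominated_convergence[where w="\<lambda>_. 1"])
    show "AE \<omega> in M. (\<lambda>n. indicator (?A n) \<omega> :: real) \<longlonglongrightarrow> 0"
      using lim
    proof eventually_elim
      case (elim \<omega>)
      then have "\<forall>\<^sub>F n in sequentially. Z n \<omega> < \<epsilon>" using \<epsilon> by (rule order_tendstoD)
      then have "\<forall>\<^sub>F n in sequentially. indicator (?A n) \<omega> = (0::real)"
        by eventually_elim (auto simp: indicator_def)
      then show ?case by (rule tendsto_eventually)
    qed
  qed (use m in \<open>auto simp: indicator_def\<close>)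
  moreover have "expectation (indicator (?A n)) = prob (?A n)" for n
    using m[of n] by (simp add: Int_absorb1 Collect_conj_eq Int_commute)
  ultimately show ?thesis by simp
qed

lemma continuous_compact_support_bounded:
  fixes f :: "real \<Rightarrow> real"
  assumes "continuous_on UNIV f" "\<forall>x. x \<notin> {a..b} \<longrightarrow> f x = 0"
  obtains C where "\<And>x. \<bar>f x\<bar> \<le> C"
proof -
  have "bounded (f ` {a..b})"
    using assms(1) by (intro compact_imp_bounded compact_continuous_image) (auto intro: continuous_on_subset)
  then obtain C where "\<forall>x\<in>{a..b}. \<bar>f x\<bar> \<le> C" by (auto simp: bounded_iff)
  with assms(2) have "\<bar>f x\<bar> \<le> max C 0" for x by (cases "x \<in> {a..b}") (auto simp: le_max_iff_disj)
  then show thesis by (rule that)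
qed

theorem theorem4p13:
  fixes M :: "'a measure" and F :: "real \<Rightarrow> 'a measure"
    and L :: "real \<Rightarrow> 'a \<Rightarrow> real" and \<Phi> :: "real \<Rightarrow> 'a \<Rightarrow> real"
    and p q r \<eta> c\<^sub>\<mu> c\<^sub>\<nu> :: real and f\<^sub>\<mu> f\<^sub>\<nu> :: "real \<Rightarrow> real"
    and X :: "real \<Rightarrow> 'a \<Rightarrow> real" and Xn :: "nat \<Rightarrow> real \<Rightarrow> 'a \<Rightarrow> real"
  assumes "prob_space M"
    and "p \<ge> 0" "q \<ge> 0" "r = max p q"
    and "usual_filtration M r F"
    and "levy_pure_jump_centered M r F L"
    and "\<eta> > 0" "c\<^sub>\<mu> > 0" "c\<^sub>\<nu> > 0"
    and "continuous_on UNIV f\<^sub>\<mu>" "\<forall>x. f\<^sub>\<mu> x \<ge> 0" "\<forall>x. x \<notin> {-p..0} \<longrightarrow> f\<^sub>\<mu> x = 0"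
    and "continuous_on UNIV f\<^sub>\<nu>" "\<forall>x. f\<^sub>\<nu> x \<ge> 0" "\<forall>x. x \<notin> {-q..0} \<longrightarrow> f\<^sub>\<nu> x = 0"
    and "\<forall>t\<in>{-r..0}. \<Phi> t \<in> borel_measurable (natural_filt M r L t)"
    and "\<forall>\<omega>\<in>space M. cadlag_on (-r) 0 (\<lambda>t. \<Phi> t \<omega>)"
    and "(\<integral>\<^sup>+\<omega>. (SUP s\<in>{-r..0}. ennreal ((\<Phi> s \<omega>)\<^sup>2)) \<partial>M) < \<infinity>"
    and "is_solution M F p q \<eta> c\<^sub>\<mu> c\<^sub>\<nu> f\<^sub>\<mu> f\<^sub>\<nu> r (sqjump r L) \<Phi> X"
    and "\<forall>n. is_solution M F p q \<eta> c\<^sub>\<mu> c\<^sub>\<nu> f\<^sub>\<mu> f\<^sub>\<nu> r (sqjump_trunc r L n) \<Phi> (Xn n)"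
  shows "ucp_conv M r Xn X"
proof -
  note solX = assms(19)[unfolded is_solution_def] and solXn = assms(20)[unfolded is_solution_def]
  have r0: "0 \<le> r" using assms(2-4) by auto
  interpret levy_setting M r F L
    by (intro levy_setting.intro levy_setting_axioms.intro assms r0)
  obtain C\<^sub>\<mu> where C\<^sub>\<mu>: "\<And>x. \<bar>f\<^sub>\<mu> x\<bar> \<le> C\<^sub>\<mu>"
    using continuous_compact_support_bounded[OF assms(10,12)] by metis
  obtain C\<^sub>\<nu> where C\<^sub>\<nu>: "\<And>x. \<bar>f\<^sub>\<nu> x\<bar> \<le> C\<^sub>\<nu>"
    using continuous_compact_support_bounded[OF assms(13,15)] by metis
  interpret K: delay_kernel p q r \<eta> c\<^sub>\<mu> c\<^sub>\<nu> C\<^sub>\<mu> C\<^sub>\<nu> f\<^sub>\<mu> f\<^sub>\<nu>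
    by unfold_locales (use assms C\<^sub>\<mu> C\<^sub>\<nu> in auto)
  have adX: "adapted r F X" and adXn: "adapted r F (Xn n)" for n
    using solX solXn by auto
  have cX: "cadlag_from (- r) (\<lambda>t. X t \<omega>)" and cXn: "cadlag_from (- r) (\<lambda>t. Xn n t \<omega>)"
    if "\<omega> \<in> space M" for \<omega> n
    using solX solXn that by auto
  define a where "a \<omega> s = (jump (\<lambda>u. L u \<omega>) s)\<^sup>2" for \<omega> s
  \<comment> \<open>For \<open>n = 0\<close> the threshold \<open>1 / real n\<close> is 0 and
    nothing is truncated, which does not affect the limit.\<close>
  define b where "b n \<omega> s = (jump (\<lambda>u. L u \<omega>) s)\<^sup>2 *
    indicator {x. \<bar>x\<bar> \<ge> 1 / real n} (jump (\<lambda>u. L u \<omega>) s)" for n \<omega> s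
  have Sa: "sqjump r L \<omega> = cumul (- r) (a \<omega>)" and Sb: "sqjump_trunc r L n \<omega> = cumul (- r) (b n \<omega>)" for n \<omega>
    by (simp_all add: fun_eq_iff sqjump_def sqjump_trunc_def cumul_def a_def b_def)
  have eqX: "AE \<omega> in M. (\<forall>t\<in>{-r..0}. X t \<omega> = \<Phi> t \<omega>) \<and>
      (\<forall>t\<ge>0. X t \<omega> = \<Phi> 0 \<omega> + (LBINT s=0..t. drift \<eta> c\<^sub>\<mu> f\<^sub>\<mu> f\<^sub>\<nu> p q (cumul (- r) (a \<omega>)) (\<lambda>u. X u \<omega>) s)
        + c\<^sub>\<nu> * stint (cumul (- r) (a \<omega>)) {0<..t} (lft (\<lambda>u. X u \<omega>)))"
    using solX unfolding Sa by blast
  have eqXn: "AE \<omega> in M. \<forall>n. (\<forall>t\<in>{-r..0}. Xn n t \<omega> = \<Phi> t \<omega>) \<and>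
      (\<forall>t\<ge>0. Xn n t \<omega> = \<Phi> 0 \<omega> + (LBINT s=0..t. drift \<eta> c\<^sub>\<mu> f\<^sub>\<mu> f\<^sub>\<nu> p q (cumul (- r) (b n \<omega>)) (\<lambda>u. Xn n u \<omega>) s)
        + c\<^sub>\<nu> * stint (cumul (- r) (b n \<omega>)) {0<..t} (lft (\<lambda>u. Xn n u \<omega>)))"
    unfolding AE_all_countable using solXn unfolding Sb by blast
  have lim: "AE \<omega> in M. (\<lambda>n. SUP s\<in>{-r..t}. \<bar>Xn n s \<omega> - X s \<omega>\<bar>) \<longlonglongrightarrow> 0" if t: "0 < t" for t
    \<comment> \<open>A single null set serves all \<open>n\<close> and all times, so the
      deterministic convergence theorem applies to every remaining path.\<close>
    using eqX eqXn AE_sq_jumps_summable AE_space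
  proof eventually_elim
    case (elim \<omega>)
    have ba: "b n \<omega> s \<le> a \<omega> s" "0 \<le> b n \<omega> s" for n s
      by (auto simp: a_def b_def indicator_def)
    have suma: "a \<omega> summable_on {- r<..T}" for T
      using elim(3) by (simp add: a_def[abs_def])
    have wa: "jump_weights (- r) (a \<omega>)"
      by unfold_locales (auto simp: suma a_def)
    have wb: "jump_weights (- r) (b n \<omega>)" for n
      by unfold_locales (auto intro: ba summable_on_comparison_test[OF suma])
    \<comment> \<open>A nonzero jump exceeds \<open>1 / real n\<close> for all large
      \<open>n\<close>, and where there is no jump both weights are 0.\<close>
    have ev: "\<forall>\<^sub>F n in sequentially. b n \<omega> s = a \<omega> s" for s
    proof (cases "jump (\<lambda>u. L u \<omega>) s = 0")
      case False
      then have "\<forall>\<^sub>F n in sequentially. 1 / real n < \<bar>jump (\<lambda>u. L u \<omega>) s\<bar>"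
        by (intro order_tendstoD(2)[OF lim_1_over_n]) simp
      then show ?thesis
        by eventually_elim (simp add: a_def b_def)
    qed (simp add: a_def b_def)
    show ?case
    proof (rule K.solutions_converge[OF wa wb ba(1) ev])
      show "K.solves (a \<omega>) (\<Phi> 0 \<omega>) (\<lambda>s. X s \<omega>)"
        using elim cX unfolding K.solves_def by blast
      show "K.solves (b n \<omega>) (\<Phi> 0 \<omega>) (\<lambda>s. Xn n s \<omega>)" for n
        using elim cXn unfolding K.solves_def by blast
      show "Xn n s \<omega> = X s \<omega>" if "- r \<le> s" "s \<le> 0" for n s
        using elim that by auto
      show "0 \<le> t" using t by simp
    qed
  qed
  have meas: "{\<omega>\<in>space M. (SUP s\<in>{-r..t}. \<bar>Xn n s \<omega> - X s \<omega>\<bar>) > \<epsilon>} \<in> sets M" if "0 < t" for n t \<epsilon>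
    using that r0
    by (intro sets_SUP_cadlag_gt[where Z="\<lambda>s \<omega>. Xn n s \<omega> - X s \<omega>"] cadlag_from_diff cX cXn
        borel_measurable_diff adapted_measurable adX adXn) auto
  show ?thesis
    unfolding ucp_conv_def
    by (intro allI impI conjI meas AE_tendsto_imp_prob_tendsto lim)
qed

end
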